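(* Let $G=(X,E)$ be a finite connected graph and $x,y,z\in X$ three distinct vertices with $a=d(x,y)\le b=d(x,z)\le c=d(y,z)$. Assume the three vertices are pairwise $c$-cospectral, and let $W=\chi_{\{x,y,z\}}$ ($W=1$ at $x,y,z$ and $0$ elsewhere), $H=\Delta-QW$. Then: (1) If $a<b\le c$, there is perfect tunneling between $x$ and $y$ ($TC(x,y)=TC(y,x)=1$) with tunneling time $\Theta(Q^{a-1})$, and there is no tunneling to or from $z$ ($TC(u,z)=TC(z,u)=0$ for $u\in\{x,y\}$). (2) If $a=b<c$ and the particle is started from $x$, it never tunnels perfectly to a single other state ($TC(x,y)<1$ and $TC(x,z)<1$), but it does tunnel to a mixed state of $y$ and $z$; this happens on the time scale $t\sim Q^{a-1}$. (3) If $a=b<c$ and the particle is started from $y$, then $TC(y,z)=1$ if and only if $c_{xy}=c_{xz}$; in that case the tunneling time is $\Theta(Q^{a-1})$.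
   Context: $G=(X,E)$ is a finite connected graph, $d_v$ the degree of $v$, $d(\cdot,\cdot)$ graph distance. The symmetrized Laplacian $\Delta$ has $\Delta(v,v)=1$, $\Delta(v,w)=-1/\sqrt{d_vd_w}$ if $vw\in E$, $0$ otherwise; $H=\Delta-QW$ with $W$ viewed as a diagonal matrix and $Q$ a real parameter. Starting from vertex $u$, the state is $\varphi_t=e^{itH}\chi_u$ ($\chi_u$ the indicator vector of $u$), depending on $Q$. $TC(u,v)=\liminf_{Q\to\infty}\sup_{t\in[0,\infty)}|\varphi_t(v)|^2$; perfect tunneling means $TC=1$, no tunneling $TC=0$. Tunneling from $u$ to $v$ happens within time $f(Q)$ if $TC(u,v)=\liminf_{Q\to\infty}\sup_{t\in[0,f(Q)]}|\varphi_t(v)|^2$; "tunneling time $\Theta(g(Q))$" means tunneling happens within some time $f(Q)=O(g(Q))$ and not within any time $f(Q)=o(g(Q))$. $PR(v,k)$ is the probability that simple random walk from $v$ is at $v$ at time $k$; $x,y$ are $m$-cospectral if $PR(x,k)=PR(y,k)$ for $0\le k\le m$. For vertices $u,v$, $c_{uv}=\sum_{P}\prod_{j=0}^{|P|-1}1/\sqrt{d_{x_j}d_{x_{j+1}}}$, the sum over all paths $P: u=x_0,x_1,\dots,x_l=v$ of length $|P|=l=d(u,v)$. *)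

theory Defs
  imports "HOL-Analysis.Analysis" "HOL-Library.Landau_Symbols"
begin

definition simple_graph :: "('a::finite \<Rightarrow> 'a \<Rightarrow> bool) \<Rightarrow> bool" where
  "simple_graph E \<longleftrightarrow> (\<forall>v w. E v w \<longrightarrow> E w v) \<and> (\<forall>v. \<not> E v v)"

definition connected_graph :: "('a::finite \<Rightarrow> 'a \<Rightarrow> bool) \<Rightarrow> bool" where
  "connected_graph E \<longleftrightarrow> (\<forall>v w. E\<^sup>*\<^sup>* v w)"

definition deg :: "('a::finite \<Rightarrow> 'a \<Rightarrow> bool) \<Rightarrow> 'a \<Rightarrow> nat" where
  "deg E v = card {w. E v w}"

definition gdist :: "('a::finite \<Rightarrow> 'a \<Rightarrow> bool) \<Rightarrow> 'a \<Rightarrow> 'a \<Rightarrow> nat" where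
  "gdist E u v = (LEAST n. (E ^^ n) u v)"

definition Lap :: "('a::finite \<Rightarrow> 'a \<Rightarrow> bool) \<Rightarrow> 'a \<Rightarrow> 'a \<Rightarrow> real" where
  "Lap E v w = (if v = w then 1 else if E v w then - 1 / sqrt (real (deg E v) * real (deg E w)) else 0)"

definition Ham :: "('a::finite \<Rightarrow> 'a \<Rightarrow> bool) \<Rightarrow> ('a \<Rightarrow> real) \<Rightarrow> real \<Rightarrow> 'a \<Rightarrow> 'a \<Rightarrow> real" where
  "Ham E W Q v w = Lap E v w - (if v = w then Q * W v else 0)"

definition matvec :: "('a::finite \<Rightarrow> 'a \<Rightarrow> real) \<Rightarrow> ('a \<Rightarrow> complex) \<Rightarrow> 'a \<Rightarrow> complex" where
  "matvec M \<psi> v = (\<Sum>w\<in>UNIV. complex_of_real (M v w) * \<psi> w)"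

definition chi :: "'a \<Rightarrow> 'a \<Rightarrow> complex" where
  "chi u = (\<lambda>v. if v = u then 1 else 0)"

text \<open>The state phi_t = e^{itH} chi_u, the matrix exponential given by its power series.\<close>
definition state :: "('a::finite \<Rightarrow> 'a \<Rightarrow> bool) \<Rightarrow> ('a \<Rightarrow> real) \<Rightarrow> real \<Rightarrow> 'a \<Rightarrow> real \<Rightarrow> 'a \<Rightarrow> complex" where
  "state E W Q u t v =
     (\<Sum>n. (\<i> * complex_of_real t) ^ n / fact n * ((matvec (Ham E W Q) ^^ n) (chi u)) v)"

definition TCset :: "('a::finite \<Rightarrow> 'a \<Rightarrow> bool) \<Rightarrow> ('a \<Rightarrow> real) \<Rightarrow> 'a \<Rightarrow> 'a set \<Rightarrow> ereal" where
  "TCset E W u S = Liminf at_top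
     (\<lambda>Q. SUP t\<in>{0..}. ereal (\<Sum>v\<in>S. (cmod (state E W Q u t v))\<^sup>2))"

definition TC :: "('a::finite \<Rightarrow> 'a \<Rightarrow> bool) \<Rightarrow> ('a \<Rightarrow> real) \<Rightarrow> 'a \<Rightarrow> 'a \<Rightarrow> ereal" where
  "TC E W u v = Liminf at_top
     (\<lambda>Q. SUP t\<in>{0..}. ereal ((cmod (state E W Q u t v))\<^sup>2))"

definition TCset_within :: "('a::finite \<Rightarrow> 'a \<Rightarrow> bool) \<Rightarrow> ('a \<Rightarrow> real) \<Rightarrow> 'a \<Rightarrow> 'a set \<Rightarrow> (real \<Rightarrow> real) \<Rightarrow> ereal" where
  "TCset_within E W u S f = Liminf at_top
     (\<lambda>Q. SUP t\<in>{0..f Q}. ereal (\<Sum>v\<in>S. (cmod (state E W Q u t v))\<^sup>2))"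

definition tunnels_within :: "('a::finite \<Rightarrow> 'a \<Rightarrow> bool) \<Rightarrow> ('a \<Rightarrow> real) \<Rightarrow> 'a \<Rightarrow> 'a set \<Rightarrow> (real \<Rightarrow> real) \<Rightarrow> bool" where
  "tunnels_within E W u S f \<longleftrightarrow> TCset E W u S = TCset_within E W u S f"

definition tunnel_time_Theta :: "('a::finite \<Rightarrow> 'a \<Rightarrow> bool) \<Rightarrow> ('a \<Rightarrow> real) \<Rightarrow> 'a \<Rightarrow> 'a set \<Rightarrow> (real \<Rightarrow> real) \<Rightarrow> bool" where
  "tunnel_time_Theta E W u S g \<longleftrightarrow>
     (\<exists>f. f \<in> O(g) \<and> tunnels_within E W u S f) \<and>
     (\<forall>f. f \<in> o(g) \<longrightarrow> \<not> tunnels_within E W u S f)"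

definition rw_step :: "('a::finite \<Rightarrow> 'a \<Rightarrow> bool) \<Rightarrow> ('a \<Rightarrow> real) \<Rightarrow> 'a \<Rightarrow> real" where
  "rw_step E p w = (\<Sum>v\<in>UNIV. p v * (if E v w then 1 / real (deg E v) else 0))"

definition PR :: "('a::finite \<Rightarrow> 'a \<Rightarrow> bool) \<Rightarrow> 'a \<Rightarrow> nat \<Rightarrow> real" where
  "PR E v k = ((rw_step E ^^ k) (\<lambda>w. if w = v then 1 else 0)) v"

definition cospectral :: "('a::finite \<Rightarrow> 'a \<Rightarrow> bool) \<Rightarrow> nat \<Rightarrow> 'a \<Rightarrow> 'a \<Rightarrow> bool" where
  "cospectral E m x y \<longleftrightarrow> (\<forall>k\<le>m. PR E x k = PR E y k)"

definition cpath :: "('a::finite \<Rightarrow> 'a \<Rightarrow> bool) \<Rightarrow> 'a \<Rightarrow> 'a \<Rightarrow> real" where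
  "cpath E u v = (let l = gdist E u v in
     \<Sum>xs\<in>{xs. length xs = Suc l \<and> xs ! 0 = u \<and> xs ! l = v \<and> (\<forall>j<l. E (xs ! j) (xs ! Suc j))}.
        \<Prod>j<l. 1 / sqrt (real (deg E (xs ! j)) * real (deg E (xs ! Suc j))))"

end

theory Submission
  imports Defs
begin

text \<open>
  Let \<open>A\<close> be the normalized adjacency operator and \<open>X\<close>, \<open>Y\<close>, \<open>Z\<close> the indicator vectors of the three
  wells. Summing walks from a well that avoid the wells, weighted by powers of \<open>1 / q\<close> with \<open>q \<approx> Q\<close>,
  gives vectors close to \<open>X\<close>, \<open>Y\<close>, \<open>Z\<close> on which \<open>H - (1 - q)\<close> acts, up to a relative error \<open>O(1 / q)\<close>,
  as \<open>- s M\<close>, where \<open>s = q\<^bsup>1 - a\<^esup>\<close> and \<open>M\<close> has the entries \<open>\<alpha> = c\<^sub>x\<^sub>y\<close>, \<open>\<beta>\<close> (which is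
  \<open>c\<^sub>x\<^sub>z\<close> if \<open>a = b\<close> and \<open>0\<close> if \<open>a < b\<close>) and \<open>0\<close> for the pairs \<open>xy\<close>, \<open>xz\<close>, \<open>yz\<close>. The diagonal of \<open>M\<close>
  vanishes because cospectrality equates the first-return weights of the wells up to length \<open>a\<close>.

  The matrix \<open>M\<close> has the simple eigenvalues \<open>\<omega>\<close>, \<open>-\<omega>\<close>, \<open>0\<close> with \<open>\<omega>\<^sup>2 = \<alpha>\<^sup>2 + \<beta>\<^sup>2\<close>. Approximate eigenvectors
  \<open>u\<close>, \<open>v\<close> of a self-adjoint operator with separated approximate eigenvalues stay almost orthogonal
  under the evolution for all times, so every transition amplitude is, uniformly in time, a
  fixed combination of the three diagonal amplitudes, each of modulus at most 1 and close to a pure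
  phase for times \<open>O(1 / s)\<close>. With \<open>y\<^sub>0 = \<alpha> / \<omega>\<close> and \<open>z\<^sub>0 = \<beta> / \<omega>\<close> the suprema of the moduli tend to at most
  \<open>y\<^sub>0\<close>, \<open>z\<^sub>0\<close> and \<open>2 y\<^sub>0 z\<^sub>0\<close> for \<open>xy\<close>, \<open>xz\<close> and \<open>yz\<close>, and these values are attained in the limit at the
  times \<open>\<pi> / (2 \<omega> s)\<close> and \<open>\<pi> / (\<omega> s)\<close>.
\<close>

section \<open>Evolution under a self-adjoint operator\<close>

text \<open>The matrix element of \<open>e^{itT}\<close> between \<open>u\<close> and
  \<open>v\<close>. Working with matrix elements keeps \<open>u\<close>, \<open>v\<close> and
  \<open>T\<close> real, so the vector space is never complexified.\<close>

definition propag :: "('v::euclidean_space \<Rightarrow> 'v) \<Rightarrow> real \<Rightarrow> 'v \<Rightarrow> 'v \<Rightarrow> complex" where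
  "propag T t u v = (\<Sum>n. (\<i> * complex_of_real t) ^ n / fact n * complex_of_real (u \<bullet> (T ^^ n) v))"

locale selfadjoint =
  fixes T :: "'v::euclidean_space \<Rightarrow> 'v"
  assumes linear_T: "linear T" and selfadj: "T u \<bullet> v = u \<bullet> T v"
begin

lemma linear_pow: "linear (T ^^ n)"
  by (induction n) (auto intro: linear_compose[OF _ linear_T, unfolded o_def] simp: linear_id[unfolded id_def] o_def id_def)

lemma selfadj_pow: "(T ^^ n) u \<bullet> v = u \<bullet> (T ^^ n) v"
  by (induction n arbitrary: u v) (simp_all add: selfadj funpow_swap1)

lemma summable_powerseries:
  "summable (\<lambda>n. complex_of_real (u \<bullet> (T ^^ n) v) / fact n * z ^ n)"
proof -
  obtain K where K: "K > 0" "\<And>w. norm (T w) \<le> norm w * K"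
    using linear_T bounded_linear.pos_bounded linear_conv_bounded_linear by blast
  have pow: "norm ((T ^^ n) v) \<le> norm v * K ^ n" for n
  proof (induction n)
    case (Suc n)
    have "norm ((T ^^ Suc n) v) \<le> norm ((T ^^ n) v) * K" using K(2) by simp
    also have "\<dots> \<le> norm v * K ^ n * K" using Suc K(1) by (intro mult_right_mono) auto
    finally show ?case by (simp add: ac_simps)
  qed simp
  have "norm (complex_of_real (u \<bullet> (T ^^ n) v) / fact n * z ^ n)
      \<le> norm u * norm v * (inverse (fact n) * (K * norm z) ^ n)" for n
  proof -
    have "\<bar>u \<bullet> (T ^^ n) v\<bar> \<le> norm u * (norm v * K ^ n)"
      using Cauchy_Schwarz_ineq2[of u "(T ^^ n) v"] pow[of n]
      by (meson mult_left_mono norm_ge_zero order_trans)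
    hence "\<bar>u \<bullet> (T ^^ n) v\<bar> * (norm z ^ n / fact n) \<le> norm u * (norm v * K ^ n) * (norm z ^ n / fact n)"
      by (intro mult_right_mono) auto
    thus ?thesis by (simp add: norm_mult norm_divide norm_power field_simps power_mult_distrib)
  qed
  moreover have "summable (\<lambda>n. norm u * norm v * (inverse (fact n) * (K * norm z) ^ n))"
    by (intro summable_mult summable_exp)
  ultimately show ?thesis by (rule summable_comparison_test'[rotated])
qed

lemma summable_propag:
  "summable (\<lambda>n. (\<i> * complex_of_real t) ^ n / fact n * complex_of_real (u \<bullet> (T ^^ n) v))"
  using summable_powerseries[of u v "\<i> * complex_of_real t"] by (simp add: field_simps)

lemma propag_0: "propag T 0 u v = u \<bullet> v"
proof -
  have "propag T 0 u v = (\<Sum>n. complex_of_real (u \<bullet> (T ^^ n) v) / fact n * 0 ^ n)"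
    unfolding propag_def by (intro suminf_cong) (simp add: field_simps)
  thus ?thesis by (simp only: powser_zero) simp
qed

lemma propag_commute: "propag T t u v = propag T t v u"
  unfolding propag_def using selfadj_pow by (simp add: inner_commute)

lemma propag_selfadj: "propag T t (T u) v = propag T t u (T v)"
  unfolding propag_def by (simp add: selfadj funpow_swap1)

lemma propag_add_right: "propag T t u (v + w) = propag T t u v + propag T t u w"
  unfolding propag_def suminf_add[OF summable_propag summable_propag]
  by (simp add: linear_add[OF linear_pow] inner_add_right algebra_simps)

lemma propag_scale_right: "propag T t u (c *\<^sub>R v) = of_real c * propag T t u v"
  unfolding propag_def suminf_mult[OF summable_propag, symmetric]
  by (simp add: linear_cmul[OF linear_pow] algebra_simps)

lemma propag_add_left: "propag T t (v + w) u = propag T t v u + propag T t w u"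
  using propag_add_right propag_commute by metis

lemma propag_scale_left: "propag T t (c *\<^sub>R v) u = of_real c * propag T t v u"
  using propag_scale_right propag_commute by metis

lemma propag_diff_right: "propag T t u (v - w) = propag T t u v - propag T t u w"
  using propag_add_right[of t u v "(-1) *\<^sub>R w"] propag_scale_right[of t u "-1" w] by simp

lemma propag_diff_left: "propag T t (v - w) u = propag T t v u - propag T t w u"
  using propag_diff_right propag_commute by metis

lemmas propag_bilinear = propag_add_left propag_add_right propag_diff_left propag_diff_right
  propag_scale_left propag_scale_right

lemma propag_sum_left: "propag T t (\<Sum>b\<in>S. c b *\<^sub>R b) v = (\<Sum>b\<in>S. of_real (c b) * propag T t b v)"
proof (induction S rule: infinite_finite_induct)
  case empty
  show ?case using propag_scale_left[of t 0 0 v] by simp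
next
  case (infinite A)
  thus ?case using propag_scale_left[of t 0 0 v] by simp
qed (simp add: propag_bilinear)

lemma propag_basis_left: "propag T t u v = (\<Sum>b\<in>Basis. of_real (u \<bullet> b) * propag T t b v)"
  using propag_sum_left[of t "\<lambda>b. u \<bullet> b" Basis v] by (simp add: euclidean_representation)

lemma propag_has_vector_derivative:
  "((\<lambda>t. propag T t u v) has_vector_derivative \<i> * propag T t u (T v)) (at t)"
proof -
  define c where "c n = complex_of_real (u \<bullet> (T ^^ n) v) / fact n" for n
  define f where "f z = (\<Sum>n. c n * z ^ n)" for z
  have eq: "propag T s u v = f (\<i> * complex_of_real s)" for s
    unfolding propag_def f_def c_def by (intro suminf_cong) (simp add: field_simps)
  have "(f has_field_derivative (\<Sum>n. diffs c n * z ^ n)) (at z)" for z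
    unfolding f_def using summable_powerseries unfolding c_def
    by (intro termdiffs_strong_converges_everywhere) auto
  moreover have "(\<Sum>n. diffs c n * (\<i> * complex_of_real t) ^ n) = propag T t u (T v)"
    unfolding propag_def
    by (intro suminf_cong) (simp add: diffs_def c_def funpow_swap1 field_simps del: of_nat_Suc)
  ultimately have "(f has_field_derivative propag T t u (T v)) (at (\<i> * complex_of_real t))" by metis
  moreover have "((\<lambda>s. \<i> * complex_of_real s) has_vector_derivative \<i>) (at t)"
    by (auto intro!: derivative_eq_intros)
  ultimately have "((f \<circ> (\<lambda>s. \<i> * complex_of_real s)) has_vector_derivative \<i> * propag T t u (T v)) (at t)"
    by (intro field_vector_diff_chain_at)
  thus ?thesis unfolding eq o_def .
qed

text \<open>Unitarity. The sum of squares has derivative zero, since the two halves of the product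
  rule cancel by the symmetry of \<open>T\<close> in an orthonormal basis, and at time 0 it is the
  squared norm.\<close>

lemma propag_norm_preserved: "(\<Sum>b\<in>Basis. (cmod (propag T t b v))\<^sup>2) = (norm v)\<^sup>2"
proof -
  define g where "g t = (\<Sum>b\<in>Basis. propag T t b v * cnj (propag T t b v))" for t
  have "(g has_vector_derivative 0) (at t)" for t
  proof -
    let ?P = "\<lambda>b. propag T t b v" and ?D = "\<lambda>b. \<i> * propag T t b (T v)"
    have "(g has_vector_derivative (\<Sum>b\<in>Basis. ?P b * cnj (?D b) + ?D b * cnj (?P b))) (at t)"
      unfolding g_def
      by (intro has_vector_derivative_sum has_vector_derivative_mult
          has_vector_derivative_cnj propag_has_vector_derivative)
    moreover have "(\<Sum>b\<in>Basis. ?P b * cnj (?D b) + ?D b * cnj (?P b)) = 0"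
    proof -
      \<comment> \<open>Since \<open>T\<close> commutes with the evolution, it can act on the basis
        vector instead of \<open>v\<close>, which exposes its matrix entries.\<close>
      have ex: "propag T t b (T v) = (\<Sum>b'\<in>Basis. of_real (T b \<bullet> b') * ?P b')" for b
        using propag_basis_left[of t "T b" v] propag_selfadj[of t b v] by simp
      have "(\<Sum>b\<in>Basis. ?P b * cnj (propag T t b (T v)))
          = (\<Sum>b\<in>Basis. \<Sum>b'\<in>Basis. of_real (T b \<bullet> b') * ?P b * cnj (?P b'))"
        unfolding ex by (simp add: sum_distrib_left algebra_simps)
      also have "\<dots> = (\<Sum>b'\<in>Basis. \<Sum>b\<in>Basis. of_real (T b \<bullet> b') * ?P b * cnj (?P b'))"
        by (rule sum.swap)
      also have "\<dots> = (\<Sum>b'\<in>Basis. propag T t b' (T v) * cnj (?P b'))"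
        unfolding ex sum_distrib_right
        by (intro sum.cong refl) (metis selfadj inner_commute)
      finally show ?thesis by (simp add: sum_subtractf algebra_simps flip: sum_distrib_left)
    qed
    ultimately show ?thesis by simp
  qed
  then obtain k where k: "\<And>t. g t = k"
    using has_vector_derivative_zero_constant[of UNIV g] by auto
  have "of_real (\<Sum>b\<in>Basis. (cmod (propag T t b v))\<^sup>2) = g t"
    unfolding g_def by (simp only: of_real_sum complex_norm_square)
  also have "\<dots> = g 0" using k by simp
  also have "\<dots> = complex_of_real (\<Sum>b\<in>Basis. (v \<bullet> b)\<^sup>2)"
    by (simp add: g_def propag_0 power2_eq_square inner_commute)
  also have "(\<Sum>b\<in>Basis. (v \<bullet> b)\<^sup>2) = (norm v)\<^sup>2"
    by (simp add: power2_norm_eq_inner euclidean_inner[of v v] flip: power2_eq_square)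
  finally show ?thesis using of_real_eq_iff by blast
qed

text \<open>Cauchy-Schwarz over the coordinates of \<open>u\<close>, with unitarity for the evolved
  \<open>v\<close>.\<close>

lemma cmod_propag_le: "cmod (propag T t u v) \<le> norm u * norm v"
proof -
  have "cmod (propag T t u v) \<le> (\<Sum>b\<in>Basis. \<bar>u \<bullet> b\<bar> * \<bar>cmod (propag T t b v)\<bar>)"
    unfolding propag_basis_left[of t u] by (intro sum_norm_le) (simp add: norm_mult)
  also have "\<dots> \<le> L2_set (\<lambda>b. u \<bullet> b) Basis * L2_set (\<lambda>b. cmod (propag T t b v)) Basis"
    by (rule L2_set_mult_ineq)
  also have "\<dots> = norm u * norm v"
    by (simp add: L2_set_def propag_norm_preserved euclidean_inner[of u u] norm_eq_sqrt_inner[of u] flip: power2_eq_square)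
  finally show ?thesis .
qed

text \<open>This bound is uniform in \<open>t\<close>: it only uses that \<open>T\<close> is self-adjoint and commutes with
  the evolution, which is why no spectral theorem is needed.\<close>
lemma quasimodes_orthogonal:
  assumes "T u = \<kappa> *\<^sub>R u + \<rho>" "T v = \<nu> *\<^sub>R v + \<sigma>"
  shows "\<bar>\<kappa> - \<nu>\<bar> * cmod (propag T t u v) \<le> norm \<rho> * norm v + norm u * norm \<sigma>"
proof -
  have "propag T t (\<kappa> *\<^sub>R u + \<rho>) v = propag T t u (\<nu> *\<^sub>R v + \<sigma>)"
    using propag_selfadj[of t u v] assms by simp
  hence "of_real (\<kappa> - \<nu>) * propag T t u v = propag T t u \<sigma> - propag T t \<rho> v"
    by (simp add: propag_bilinear algebra_simps)
  hence "\<bar>\<kappa> - \<nu>\<bar> * cmod (propag T t u v) = cmod (propag T t u \<sigma> - propag T t \<rho> v)"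
    by (metis norm_mult norm_of_real real_norm_def)
  also have "\<dots> \<le> cmod (propag T t u \<sigma>) + cmod (propag T t \<rho> v)" by (rule norm_triangle_ineq4)
  finally show ?thesis using cmod_propag_le[of t u \<sigma>] cmod_propag_le[of t \<rho> v] by linarith
qed

text \<open>Duhamel's argument: once the expected phase is divided out, only the residual
  \<open>\<rho>\<close> drives the amplitude, so the drift is at most linear in time.\<close>

lemma quasimode_phase:
  assumes "T u = \<kappa> *\<^sub>R u + \<rho>" "t \<ge> 0"
  shows "cmod (propag T t u u - cis (t * \<kappa>) * (norm u)\<^sup>2) \<le> t * (norm u * norm \<rho>)"
proof -
  define g where "g t = cis (- t * \<kappa>) * propag T t u u" for t
  have d: "(g has_vector_derivative \<i> * cis (- t * \<kappa>) * propag T t u \<rho>) (at t)" for t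
  proof -
    have "((\<lambda>t. cis (- t * \<kappa>)) has_vector_derivative - \<kappa> *\<^sub>R (\<i> * cis (- t * \<kappa>))) (at t)"
      using exp_scaleR_has_vector_derivative_right[of "- (\<i> * of_real \<kappa>)" t UNIV]
      by (simp add: cis_conv_exp scaleR_conv_of_real algebra_simps)
    hence "(g has_vector_derivative cis (- t * \<kappa>) * (\<i> * propag T t u (T u))
         + (- \<kappa> *\<^sub>R (\<i> * cis (- t * \<kappa>))) * propag T t u u) (at t)"
      unfolding g_def by (intro has_vector_derivative_mult propag_has_vector_derivative)
    moreover have "cis (- t * \<kappa>) * (\<i> * propag T t u (T u))
         + (- \<kappa> *\<^sub>R (\<i> * cis (- t * \<kappa>))) * propag T t u u = \<i> * cis (- t * \<kappa>) * propag T t u \<rho>"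
      unfolding assms(1) by (simp add: propag_bilinear algebra_simps scaleR_conv_of_real)
    ultimately show ?thesis by simp
  qed
  have "norm (g t - g 0) \<le> (norm u * norm \<rho>) * norm (t - 0)"
  proof (rule differentiable_bound[of "{0..t}" g "\<lambda>s h. h *\<^sub>R (\<i> * cis (- s * \<kappa>) * propag T s u \<rho>)"])
    fix s assume "s \<in> {0..t}"
    show "(g has_derivative (\<lambda>h. h *\<^sub>R (\<i> * cis (- s * \<kappa>) * propag T s u \<rho>))) (at s within {0..t})"
      using d[of s] has_derivative_at_withinI unfolding has_vector_derivative_def by blast
    show "onorm (\<lambda>h. h *\<^sub>R (\<i> * cis (- s * \<kappa>) * propag T s u \<rho>)) \<le> norm u * norm \<rho>"
      using cmod_propag_le[of s u \<rho>]
      by (intro onorm_le) (simp add: norm_mult mult.commute mult_left_mono)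
  qed (use assms in auto)
  moreover have "g t - g 0 = cis (- t * \<kappa>) * (propag T t u u - cis (t * \<kappa>) * (norm u)\<^sup>2)"
    by (simp add: g_def propag_0 power2_norm_eq_inner right_diff_distrib cis_mult flip: mult.assoc)
  ultimately show ?thesis using assms(2) by (simp add: norm_mult mult.commute)
qed

text \<open>Used to trade well states for nearby quasimodes at a cost that does not grow with
  \<open>t\<close>.\<close>

lemma propag_perturb:
  "cmod (propag T t u v - propag T t u' v') \<le> norm (u - u') * norm v + norm u' * norm (v - v')"
proof -
  have "propag T t u v - propag T t u' v' = propag T t (u - u') v + propag T t u' (v - v')"
    by (simp add: propag_bilinear)
  thus ?thesis using cmod_propag_le[of t "u - u'" v] cmod_propag_le[of t u' "v - v'"]
    by (smt (verit) norm_triangle_ineq)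
qed

end

section \<open>Three wells in resonance\<close>

lemma norm_le_of_coeff: "\<bar>k\<bar> \<le> 1 \<Longrightarrow> cmod w \<le> d \<Longrightarrow> cmod (of_real k * w) \<le> d"
  by (simp add: norm_mult) (meson abs_ge_zero mult_left_le_one_le norm_ge_zero order_trans)

lemma cmod_le_of_approx:
  assumes "cmod (w - of_real k * v) < e" "k \<ge> 0" "cmod v \<le> d"
  shows "cmod w \<le> k * d + e"
proof -
  have "cmod w \<le> cmod (of_real k * v) + cmod (w - of_real k * v)" by (rule norm_triangle_sub)
  moreover have "cmod (of_real k * v) \<le> k * d"
    using assms by (simp add: norm_mult mult_left_mono)
  ultimately show ?thesis using assms(1) by linarith
qed

lemma cmod_ge_of_approx:
  assumes "cmod (w - of_real k * v) < e" "k \<ge> 0" "cmod v \<ge> d"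
  shows "cmod w \<ge> k * d - e"
proof -
  have "cmod (of_real k * v) \<le> cmod w + cmod (of_real k * v - w)" by (rule norm_triangle_sub)
  moreover have "cmod (of_real k * v) \<ge> k * d"
    using assms by (simp add: norm_mult mult_left_mono)
  ultimately show ?thesis using assms(1) norm_minus_commute[of w] by (smt (verit))
qed

text \<open>If \<open>r k\<close> is the weight of the closed walks of length \<open>k\<close> at a vertex, the renewal equation
  recovers from it the weight of those returning for the first time at step \<open>k\<close>.\<close>
function first_return :: "(nat \<Rightarrow> real) \<Rightarrow> nat \<Rightarrow> real" where
  "first_return r k = r k - (\<Sum>j\<in>{1..<k}. first_return r j * r (k - j))"
  by auto
termination by lexicographic_order

declare first_return.simps [simp del]

text \<open>The graph seen through matrix elements of \<open>A\<close>: the \<open>ret\<close>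
  assumptions carry cospectrality, the \<open>off\<close> assumptions carry the distances, and their
  instances at \<open>k = 0\<close> make the wells orthonormal. Allowing \<open>\<beta> = 0\<close>
  treats \<open>a < b\<close> and \<open>a = b\<close> together; \<open>off_YZ\<close> includes
  \<open>k = a\<close> because \<open>a < c\<close>.\<close>

locale three_wells = selfadjoint A for A :: "'v::euclidean_space \<Rightarrow> 'v" +
  fixes X Y Z :: 'v and a :: nat and r :: "nat \<Rightarrow> real" and \<alpha> \<beta> :: real
  assumes a_pos: "a > 0"
    and ret_X: "\<And>k. k \<le> a \<Longrightarrow> X \<bullet> (A ^^ k) X = r k"
    and ret_Y: "\<And>k. k \<le> a \<Longrightarrow> Y \<bullet> (A ^^ k) Y = r k"
    and ret_Z: "\<And>k. k \<le> a \<Longrightarrow> Z \<bullet> (A ^^ k) Z = r k"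
    and r_0: "r 0 = 1"
    and off_XY: "\<And>k. k < a \<Longrightarrow> X \<bullet> (A ^^ k) Y = 0"
    and off_XZ: "\<And>k. k < a \<Longrightarrow> X \<bullet> (A ^^ k) Z = 0"
    and off_YZ: "\<And>k. k \<le> a \<Longrightarrow> Y \<bullet> (A ^^ k) Z = 0"
    and hop_XY: "X \<bullet> (A ^^ a) Y = \<alpha>"
    and hop_XZ: "X \<bullet> (A ^^ a) Z = \<beta>"
    and \<alpha>_pos: "\<alpha> > 0" and \<beta>_nonneg: "\<beta> \<ge> 0"
begin

section \<open>The Hamiltonian and walks that avoid the wells\<close>

definition well :: "'v \<Rightarrow> 'v" where
  "well v = (v \<bullet> X) *\<^sub>R X + (v \<bullet> Y) *\<^sub>R Y + (v \<bullet> Z) *\<^sub>R Z"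

definition ham :: "real \<Rightarrow> 'v \<Rightarrow> 'v" where
  "ham Q v = v - A v - Q *\<^sub>R well v"

abbreviation "f \<equiv> first_return r"

text \<open>For \<open>1 \<le> k < a\<close> and \<open>u\<close> a well, \<open>zeta k u\<close> vanishes on all wells: it sums the walks of
  length \<open>k\<close> from \<open>u\<close> that never return to \<open>u\<close>, and these are too short to meet another well.\<close>
definition zeta :: "nat \<Rightarrow> 'v \<Rightarrow> 'v" where
  "zeta k u = (A ^^ k) u - (\<Sum>j\<in>{1..k}. f j *\<^sub>R (A ^^ (k - j)) u)"

lemma linear_well: "linear well"
  by (rule linearI) (simp_all add: well_def algebra_simps)

lemma selfadjoint_ham: "selfadjoint (ham Q)"
proof (rule selfadjoint.intro)
  show "linear (ham Q)"
    unfolding ham_def [abs_def]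
    by (intro linear_compose_sub linear_compose_scale_right linear_T linear_well linear_ident)
  show "ham Q u \<bullet> v = u \<bullet> ham Q v" for u v
    by (simp add: ham_def well_def selfadj inner_diff_left inner_diff_right inner_add_left inner_add_right
        inner_commute[of X] inner_commute[of Y] inner_commute[of Z] mult.commute)
qed

sublocale ham: selfadjoint "ham Q" for Q by (rule selfadjoint_ham)

lemma zeta_0 [simp]: "zeta 0 u = u"
  by (simp add: zeta_def)

text \<open>In terms of walks from a well: a walk that has not returned takes one more step and
  either still has not returned or makes its first return. The identity itself is an index
  shift.\<close>

lemma A_zeta: "A (zeta k u) = zeta (Suc k) u + f (Suc k) *\<^sub>R u"
proof -
  have "A (zeta k u) = (A ^^ Suc k) u - (\<Sum>j\<in>{1..k}. f j *\<^sub>R (A ^^ Suc (k - j)) u)"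
    by (simp add: zeta_def linear_diff[OF linear_T] linear_sum[OF linear_T] linear_cmul[OF linear_T])
  also have "(\<Sum>j\<in>{1..k}. f j *\<^sub>R (A ^^ Suc (k - j)) u) = (\<Sum>j\<in>{1..k}. f j *\<^sub>R (A ^^ (Suc k - j)) u)"
    by (intro sum.cong) (auto simp: Suc_diff_le)
  finally show ?thesis by (simp add: zeta_def)
qed

lemma linear_zeta: "linear (zeta k)"
  unfolding zeta_def [abs_def]
  by (intro linear_compose_sub linear_compose_sum linear_compose_scale_right linear_pow ballI)

text \<open>The subtracted terms belong to strictly shorter walks, which do not yet reach
  \<open>w\<close>.\<close>

lemma inner_zeta_off:
  assumes "\<And>k. k < n \<Longrightarrow> w \<bullet> (A ^^ k) u = 0" "k \<le> n"
  shows "w \<bullet> zeta k u = w \<bullet> (A ^^ k) u"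
  using assms by (auto simp: zeta_def inner_diff_right inner_sum_right intro!: sum.neutral)

text \<open>This is the renewal equation that defines \<open>first_return\<close>.\<close>

lemma inner_zeta_self:
  assumes "\<And>k. k \<le> a \<Longrightarrow> u \<bullet> (A ^^ k) u = r k" "1 \<le> k" "k \<le> a"
  shows "u \<bullet> zeta k u = 0"
proof -
  have "u \<bullet> zeta k u = r k - (\<Sum>j\<in>{1..k}. f j * r (k - j))"
    using assms by (simp add: zeta_def inner_diff_right inner_sum_right)
  \<comment> \<open>The term \<open>j = k\<close> carries \<open>r 0 = 1\<close>, so it contributes
    \<open>f k\<close> itself.\<close>
  also have "{1..k} = insert k {1..<k}" using assms by auto
  finally show ?thesis using first_return.simps[of r k] by (simp add: r_0)
qed

text \<open>For \<open>u\<close> in the span of the wells, \<open>well (zeta a u)\<close> is the leading hopping term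
  of order \<open>Q\<^bsup>1 - a\<^esup>\<close>; a mode is an eigenvector of it with eigenvalue \<open>\<mu>\<close>.\<close>
definition mode :: "real \<Rightarrow> 'v \<Rightarrow> bool" where
  "mode \<mu> u \<longleftrightarrow> well u = u \<and> (\<forall>k. 1 \<le> k \<longrightarrow> k < a \<longrightarrow> well (zeta k u) = 0) \<and> well (zeta a u) = \<mu> *\<^sub>R u"

lemma well_XYZ: "well X = X" "well Y = Y" "well Z = Z"
  using ret_X[of 0] ret_Y[of 0] ret_Z[of 0] off_XY[of 0] off_XZ[of 0] off_YZ[of 0] a_pos r_0
  by (simp_all add: well_def inner_commute)

lemma inner_flip: "u \<bullet> (A ^^ k) v = v \<bullet> (A ^^ k) u"
  using selfadj_pow[of k u v] by (simp add: inner_commute)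

text \<open>The columns of the hopping matrix \<open>M\<close>: first returns have been removed from
  the diagonal, and walks between different wells first contribute at length
  \<open>a\<close>.\<close>

lemma well_zeta:
  assumes "1 \<le> k" "k \<le> a"
  shows "well (zeta k X) = (if k = a then \<alpha> *\<^sub>R Y + \<beta> *\<^sub>R Z else 0)"
    and "well (zeta k Y) = (if k = a then \<alpha> *\<^sub>R X else 0)"
    and "well (zeta k Z) = (if k = a then \<beta> *\<^sub>R X else 0)"
proof -
  have YX: "k < a \<Longrightarrow> Y \<bullet> (A ^^ k) X = 0" "Y \<bullet> (A ^^ a) X = \<alpha>" for k
    using off_XY hop_XY inner_flip by metis+
  have ZX: "k < a \<Longrightarrow> Z \<bullet> (A ^^ k) X = 0" "Z \<bullet> (A ^^ a) X = \<beta>" for k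
    using off_XZ hop_XZ inner_flip by metis+
  have ZY: "k \<le> a \<Longrightarrow> Z \<bullet> (A ^^ k) Y = 0" for k
    using off_YZ inner_flip by metis
  note s = well_def inner_commute[of "zeta _ _"]
  show "well (zeta k X) = (if k = a then \<alpha> *\<^sub>R Y + \<beta> *\<^sub>R Z else 0)"
    using assms inner_zeta_self[OF ret_X, of k] inner_zeta_off[of a Y X k] inner_zeta_off[of a Z X k] YX ZX
    by (simp add: s)
  show "well (zeta k Y) = (if k = a then \<alpha> *\<^sub>R X else 0)"
    using assms inner_zeta_self[OF ret_Y, of k] inner_zeta_off[of a X Y k] inner_zeta_off[of a Z Y k] ZY off_XY hop_XY
    by (simp add: s)
  show "well (zeta k Z) = (if k = a then \<beta> *\<^sub>R X else 0)"
    using assms inner_zeta_self[OF ret_Z, of k] inner_zeta_off[of a X Z k] inner_zeta_off[of a Y Z k] off_YZ off_XZ hop_XZ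
    by (simp add: s)
qed

text \<open>The three hypotheses say that \<open>(d1, d2, d3)\<close> is an eigenvector of
  \<open>M\<close> with eigenvalue \<open>\<mu>\<close>.\<close>

lemma mode_combination:
  assumes "\<alpha> * d2 + \<beta> * d3 = \<mu> * d1" "\<alpha> * d1 = \<mu> * d2" "\<beta> * d1 = \<mu> * d3"
  shows "mode \<mu> (d1 *\<^sub>R X + d2 *\<^sub>R Y + d3 *\<^sub>R Z)"
proof -
  let ?u = "d1 *\<^sub>R X + d2 *\<^sub>R Y + d3 *\<^sub>R Z"
  have wz: "well (zeta k ?u) = d1 *\<^sub>R well (zeta k X) + d2 *\<^sub>R well (zeta k Y) + d3 *\<^sub>R well (zeta k Z)" for k
    by (simp add: linear_add[OF linear_zeta] linear_cmul[OF linear_zeta]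
        linear_add[OF linear_well] linear_cmul[OF linear_well])
  have "well (zeta a ?u) = d1 *\<^sub>R (\<alpha> *\<^sub>R Y + \<beta> *\<^sub>R Z) + d2 *\<^sub>R (\<alpha> *\<^sub>R X) + d3 *\<^sub>R (\<beta> *\<^sub>R X)"
    unfolding wz using a_pos by (simp add: well_zeta)
  also have "\<dots> = (\<alpha> * d2 + \<beta> * d3) *\<^sub>R X + (\<alpha> * d1) *\<^sub>R Y + (\<beta> * d1) *\<^sub>R Z"
    by (simp add: algebra_simps)
  also have "\<dots> = \<mu> *\<^sub>R ?u" unfolding assms by (simp add: algebra_simps)
  finally show ?thesis
    unfolding mode_def using wz[of 0] by (auto simp: wz well_zeta well_XYZ)
qed

section \<open>Approximate eigenvectors of the Hamiltonian\<close>

definition quasimode :: "real \<Rightarrow> 'v \<Rightarrow> real \<Rightarrow> 'v" where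
  "quasimode \<mu> u q = (\<Sum>k<a. (1 / q) ^ k *\<^sub>R zeta k u) + (1 / q) ^ a *\<^sub>R (zeta a u - \<mu> *\<^sub>R u)"

definition residual :: "real \<Rightarrow> 'v \<Rightarrow> real \<Rightarrow> 'v" where
  "residual \<mu> u q = \<mu> *\<^sub>R (quasimode \<mu> u q - u) - (1 / q) *\<^sub>R A (zeta a u - \<mu> *\<^sub>R u)"

text \<open>The weighted sum over walks telescopes: \<open>A\<close> shifts each term to the next,
  and multiplication by \<open>q\<close> shifts it back. First returns produce multiples of
  \<open>u\<close>, which the relation between \<open>Q\<close> and \<open>q\<close> cancels. What
  survives is the hopping term and one term smaller by a factor \<open>1 / q\<close>.\<close>

lemma ham_quasimode:
  assumes "mode \<mu> u" "q \<noteq> 0" "Q = q - (\<Sum>k<a. f (Suc k) * (1 / q) ^ k)"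
  shows "ham Q (quasimode \<mu> u q) =
    (1 - q - (1 / q) ^ (a - 1) * \<mu>) *\<^sub>R quasimode \<mu> u q + (1 / q) ^ (a - 1) *\<^sub>R residual \<mu> u q"
proof -
  obtain m where m: "a = Suc m" using a_pos gr0_implies_Suc by blast
  define e where "e = 1 / q"
  have qe: "q * e = 1" using assms(2) by (simp add: e_def)
  \<comment> \<open>Subtracting \<open>\<mu>\<close> times \<open>u\<close> removes the component of
    \<open>zeta a u\<close> on the wells, so that the whole quasimode projects to exactly
    \<open>u\<close>.\<close>
  define \<eta> where "\<eta> = zeta a u - \<mu> *\<^sub>R u"
  define R where "R = (\<Sum>k<m. e ^ k *\<^sub>R zeta (Suc k) u)"
  let ?\<xi> = "quasimode \<mu> u q"
  have xi: "?\<xi> = u + e *\<^sub>R R + e ^ a *\<^sub>R \<eta>"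
    unfolding quasimode_def R_def \<eta>_def[symmetric] e_def[symmetric]
    unfolding m sum.lessThan_Suc_shift by (simp add: scaleR_sum_right)
  have "well (zeta (Suc k) u) = 0" if "k < m" for k
    using assms(1) that m unfolding mode_def by auto
  hence "well R = 0"
    by (simp add: R_def linear_sum[OF linear_well] linear_cmul[OF linear_well])
  moreover have "well u = u" "well \<eta> = 0"
    using assms(1) by (simp_all add: mode_def \<eta>_def linear_diff[OF linear_well] linear_cmul[OF linear_well])
  ultimately have well: "well ?\<xi> = u"
    by (simp add: xi linear_add[OF linear_well] linear_cmul[OF linear_well])
  have "A ?\<xi> = (\<Sum>k<a. e ^ k *\<^sub>R A (zeta k u)) + e ^ a *\<^sub>R A \<eta>"
    unfolding quasimode_def \<eta>_def[symmetric] e_def[symmetric]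
    by (simp add: linear_add[OF linear_T] linear_cmul[OF linear_T] linear_sum[OF linear_T])
  also have "(\<Sum>k<a. e ^ k *\<^sub>R A (zeta k u)) = R + e ^ m *\<^sub>R zeta a u + (\<Sum>k<a. f (Suc k) * e ^ k) *\<^sub>R u"
    by (simp add: A_zeta R_def m scaleR_add_right sum.distrib scaleR_sum_left algebra_simps)
  also have "(\<Sum>k<a. f (Suc k) * e ^ k) = q - Q" using assms(3) by (simp add: e_def)
  finally have A: "A ?\<xi> = R + e ^ m *\<^sub>R zeta a u + (q - Q) *\<^sub>R u + e ^ a *\<^sub>R A \<eta>" .
  have "q *\<^sub>R ?\<xi> = q *\<^sub>R u + R + e ^ m *\<^sub>R \<eta>"
    unfolding xi using qe by (simp add: scaleR_add_right m flip: mult.assoc)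
  hence "ham Q ?\<xi> - (1 - q) *\<^sub>R ?\<xi> = - (e ^ m * \<mu>) *\<^sub>R u - e ^ a *\<^sub>R A \<eta>"
    unfolding ham_def well A by (simp add: \<eta>_def algebra_simps)
  \<comment> \<open>Replacing \<open>u\<close> by the quasimode gives an eigenvalue equation; the
    difference goes into the residual.\<close>
  moreover have "- (e ^ m * \<mu>) *\<^sub>R u - e ^ a *\<^sub>R A \<eta> = - (e ^ m * \<mu>) *\<^sub>R ?\<xi> + e ^ m *\<^sub>R residual \<mu> u q"
    unfolding residual_def e_def[symmetric] \<eta>_def[symmetric] by (simp add: m algebra_simps)
  ultimately show ?thesis unfolding e_def[symmetric] by (simp add: m algebra_simps)
qed

lemma quasimode_tendsto: "(quasimode \<mu> u \<longlongrightarrow> u) at_top"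
proof -
  have inv: "((\<lambda>q::real. 1 / q) \<longlongrightarrow> 0) at_top"
    using tendsto_inverse_0_at_top[OF filterlim_ident] by (simp add: inverse_eq_divide)
  have "(quasimode \<mu> u \<longlongrightarrow> (\<Sum>k<a. 0 ^ k *\<^sub>R zeta k u) + 0 ^ a *\<^sub>R (zeta a u - \<mu> *\<^sub>R u)) at_top"
    unfolding quasimode_def by (intro tendsto_intros inv)
  also have "(\<Sum>k<a. 0 ^ k *\<^sub>R zeta k u) = (\<Sum>k<a. if k = 0 then u else 0)"
    by (intro sum.cong) (auto simp: power_0_left)
  finally show ?thesis using a_pos by (simp add: power_0_left)
qed

lemma residual_tendsto: "(residual \<mu> u \<longlongrightarrow> 0) at_top"
proof -
  have inv: "((\<lambda>q::real. 1 / q) \<longlongrightarrow> 0) at_top"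
    using tendsto_inverse_0_at_top[OF filterlim_ident] by (simp add: inverse_eq_divide)
  have "(residual \<mu> u \<longlongrightarrow> \<mu> *\<^sub>R (u - u) - 0 *\<^sub>R A (zeta a u - \<mu> *\<^sub>R u)) at_top"
    unfolding residual_def by (intro tendsto_intros inv quasimode_tendsto)
  thus ?thesis by simp
qed

text \<open>The energy of the quasimodes is \<open>1 - q\<close>; the equation for \<open>q\<close> makes the diagonal part of the
  effective Hamiltonian vanish exactly. It is the same for the three wells by cospectrality.\<close>
lemma shifted_coupling_exists:
  "\<exists>q. \<forall>\<^sub>F Q in at_top. Q / 2 \<le> q Q \<and> q Q \<le> 2 * Q \<and> Q = q Q - (\<Sum>k<a. f (Suc k) * (1 / q Q) ^ k)"
proof -
  define S where "S = (\<Sum>k<a. \<bar>f (Suc k)\<bar>)"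
  have S: "\<bar>\<Sum>k<a. f (Suc k) * (1 / q) ^ k\<bar> \<le> S" if "q \<ge> 1" for q :: real
    unfolding S_def using that
    by (intro order_trans[OF sum_abs] sum_mono) (simp add: abs_mult power_le_one mult_left_le)
  have "\<exists>q. Q / 2 \<le> q \<and> q \<le> 2 * Q \<and> Q = q - (\<Sum>k<a. f (Suc k) * (1 / q) ^ k)"
    if Q: "Q \<ge> 2" "Q \<ge> 2 * S" for Q
  proof -
    let ?g = "\<lambda>q. q - (\<Sum>k<a. f (Suc k) * (1 / q) ^ k)"
    \<comment> \<open>The correction is at most \<open>S\<close>, hence at most
      \<open>Q / 2\<close>, so \<open>Q / 2\<close> and \<open>2 * Q\<close> bracket a solution;
      \<open>Q \<ge> 2\<close> puts both in the range where the bound by \<open>S\<close>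
      applies.\<close>
    have "?g (Q / 2) \<le> Q" using S[of "Q / 2"] Q by linarith
    moreover have "Q \<le> ?g (2 * Q)" using S[of "2 * Q"] Q by linarith
    moreover have "continuous_on {Q / 2..2 * Q} ?g"
      using Q by (intro continuous_intros) auto
    ultimately show ?thesis using IVT'[of ?g "Q / 2" Q "2 * Q"] Q by auto
  qed
  hence "\<forall>Q. \<exists>q. Q \<ge> max 2 (2 * S) \<longrightarrow>
      Q / 2 \<le> q \<and> q \<le> 2 * Q \<and> Q = q - (\<Sum>k<a. f (Suc k) * (1 / q) ^ k)" by auto
  from choice[OF this] obtain q where "\<forall>Q. Q \<ge> max 2 (2 * S) \<longrightarrow>
      Q / 2 \<le> q Q \<and> q Q \<le> 2 * Q \<and> Q = q Q - (\<Sum>k<a. f (Suc k) * (1 / q Q) ^ k)"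
    by (elim exE)
  thus ?thesis unfolding eventually_at_top_linorder by blast
qed

definition q :: "real \<Rightarrow> real" where
  "q = (SOME q. \<forall>\<^sub>F Q in at_top. Q / 2 \<le> q Q \<and> q Q \<le> 2 * Q \<and> Q = q Q - (\<Sum>k<a. f (Suc k) * (1 / q Q) ^ k))"

lemma eventually_q:
  "\<forall>\<^sub>F Q in at_top. Q / 2 \<le> q Q \<and> q Q \<le> 2 * Q \<and> Q = q Q - (\<Sum>k<a. f (Suc k) * (1 / q Q) ^ k)"
  unfolding q_def by (rule someI_ex[OF shifted_coupling_exists])

lemma q_at_top: "filterlim q at_top at_top"
proof (rule filterlim_at_top_mono)
  show "filterlim (\<lambda>Q::real. Q / 2) at_top at_top"
    by (simp add: filterlim_tendsto_pos_mult_at_top[of "\<lambda>_. 1 / 2" "1 / 2" _ "\<lambda>Q. Q", simplified] filterlim_ident)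
  show "\<forall>\<^sub>F Q in at_top. Q / 2 \<le> q Q" using eventually_q by eventually_elim simp
qed

section \<open>The hopping scale and the evolution of the modes\<close>

definition s :: "real \<Rightarrow> real" where "s Q = (1 / q Q) ^ (a - 1)"

lemma eventually_quasimode:
  assumes "mode \<mu> u"
  shows "\<forall>\<^sub>F Q in at_top. s Q > 0 \<and> ham Q (quasimode \<mu> u (q Q)) =
    (1 - q Q - s Q * \<mu>) *\<^sub>R quasimode \<mu> u (q Q) + s Q *\<^sub>R residual \<mu> u (q Q)"
  using eventually_q eventually_gt_at_top[of 0]
proof eventually_elim
  case (elim Q)
  thus ?case using ham_quasimode[OF assms, of "q Q" Q] by (simp add: s_def)
qed

text \<open>The gap between the two energies and both residuals carry the same factor
  \<open>s Q\<close>. It cancels, leaving a bound by the vanishing residuals that is uniform in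
  time.\<close>

lemma modes_decouple:
  assumes "mode \<mu> u" "mode \<nu> v" "\<mu> \<noteq> \<nu>" "e > 0"
  shows "\<forall>\<^sub>F Q in at_top. \<forall>t. cmod (propag (ham Q) t u v) < e"
proof -
  \<comment> \<open>The first two terms pay for replacing \<open>u\<close> and \<open>v\<close> by
    their quasimodes, the quotient is the bound from \<open>quasimodes_orthogonal\<close> with
    \<open>s Q\<close> cancelled.\<close>
  define g where "g p = norm (u - quasimode \<mu> u p) * norm v
      + norm (quasimode \<mu> u p) * norm (v - quasimode \<nu> v p)
      + (norm (residual \<mu> u p) * norm (quasimode \<nu> v p)
         + norm (quasimode \<mu> u p) * norm (residual \<nu> v p)) / \<bar>\<mu> - \<nu>\<bar>" for p
  have "(g \<longlongrightarrow> norm (u - u) * norm v + norm u * norm (v - v)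
        + (norm (0::'v) * norm v + norm u * norm (0::'v)) / \<bar>\<mu> - \<nu>\<bar>) at_top"
    unfolding g_def using assms(3)
    by (intro tendsto_intros quasimode_tendsto residual_tendsto) auto
  hence "((\<lambda>Q. g (q Q)) \<longlongrightarrow> 0) at_top"
    using filterlim_compose[OF _ q_at_top] by simp
  hence "\<forall>\<^sub>F Q in at_top. g (q Q) < e" using assms(4) by (rule order_tendstoD)
  thus ?thesis using eventually_quasimode[OF assms(1)] eventually_quasimode[OF assms(2)]
  proof eventually_elim
    case (elim Q)
    let ?u = "quasimode \<mu> u (q Q)" and ?v = "quasimode \<nu> v (q Q)"
    let ?\<rho> = "residual \<mu> u (q Q)" and ?\<sigma> = "residual \<nu> v (q Q)"
    show ?case
    proof
      fix t
      have "\<bar>(1 - q Q - s Q * \<mu>) - (1 - q Q - s Q * \<nu>)\<bar> * cmod (propag (ham Q) t ?u ?v)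
          \<le> norm (s Q *\<^sub>R ?\<rho>) * norm ?v + norm ?u * norm (s Q *\<^sub>R ?\<sigma>)"
        using elim by (intro ham.quasimodes_orthogonal) auto
      also have "(1 - q Q - s Q * \<mu>) - (1 - q Q - s Q * \<nu>) = s Q * (\<nu> - \<mu>)" by (simp add: algebra_simps)
      also have "\<bar>s Q * (\<nu> - \<mu>)\<bar> = s Q * \<bar>\<mu> - \<nu>\<bar>" using elim by (simp add: abs_mult abs_minus_commute)
      finally have "s Q * (\<bar>\<mu> - \<nu>\<bar> * cmod (propag (ham Q) t ?u ?v))
          \<le> s Q * (norm ?\<rho> * norm ?v + norm ?u * norm ?\<sigma>)"
        using elim by (simp add: distrib_left mult.assoc mult.left_commute)
      hence "\<bar>\<mu> - \<nu>\<bar> * cmod (propag (ham Q) t ?u ?v) \<le> norm ?\<rho> * norm ?v + norm ?u * norm ?\<sigma>"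
        using elim by (simp only: mult_le_cancel_left_pos)
      hence "cmod (propag (ham Q) t ?u ?v) \<le> (norm ?\<rho> * norm ?v + norm ?u * norm ?\<sigma>) / \<bar>\<mu> - \<nu>\<bar>"
        using assms(3) by (simp add: pos_le_divide_eq mult.commute)
      moreover have "cmod (propag (ham Q) t u v)
          \<le> cmod (propag (ham Q) t ?u ?v) + cmod (propag (ham Q) t u v - propag (ham Q) t ?u ?v)"
        by (rule norm_triangle_sub)
      ultimately show "cmod (propag (ham Q) t u v) < e"
        using ham.propag_perturb[of Q t u v ?u ?v] elim unfolding g_def by linarith
    qed
  qed
qed

text \<open>Over times with \<open>t * s Q \<le> K\<close> the drift is at most \<open>K\<close>
  times a vanishing residual, so the phase of the approximate energy stays correct.\<close>

lemma mode_phase: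
  assumes "mode \<mu> u" "norm u = 1" "e > 0" "K \<ge> 0"
  shows "\<forall>\<^sub>F Q in at_top. \<forall>t\<ge>0. t * s Q \<le> K \<longrightarrow>
    cmod (propag (ham Q) t u u - cis (t * (1 - q Q)) * cis (- (t * s Q * \<mu>))) < e"
proof -
  define g where "g p = norm (u - quasimode \<mu> u p) * norm u
      + norm (quasimode \<mu> u p) * norm (u - quasimode \<mu> u p)
      + \<bar>(norm (quasimode \<mu> u p))\<^sup>2 - 1\<bar>
      + K * (norm (quasimode \<mu> u p) * norm (residual \<mu> u p))" for p
  have "(g \<longlongrightarrow> norm (u - u) * norm u + norm u * norm (u - u) + \<bar>(norm u)\<^sup>2 - 1\<bar>
        + K * (norm u * norm (0::'v))) at_top"
    unfolding g_def
    by (intro tendsto_intros quasimode_tendsto residual_tendsto)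
  hence "((\<lambda>Q. g (q Q)) \<longlongrightarrow> 0) at_top"
    using filterlim_compose[OF _ q_at_top] assms(2) by simp
  hence "\<forall>\<^sub>F Q in at_top. g (q Q) < e" using assms(3) by (rule order_tendstoD)
  thus ?thesis using eventually_quasimode[OF assms(1)]
  proof eventually_elim
    case (elim Q)
    let ?u = "quasimode \<mu> u (q Q)" and ?\<rho> = "residual \<mu> u (q Q)"
    show ?case
    proof (intro allI impI)
      fix t :: real assume t: "t \<ge> 0" "t * s Q \<le> K"
      define w where "w = cis (t * (1 - q Q - s Q * \<mu>))"
      have "cmod (propag (ham Q) t ?u ?u - w * (norm ?u)\<^sup>2) \<le> t * (norm ?u * norm (s Q *\<^sub>R ?\<rho>))"
        unfolding w_def using elim t by (intro ham.quasimode_phase) auto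
      also have "\<dots> = (t * s Q) * (norm ?u * norm ?\<rho>)" using elim by simp
      also have "\<dots> \<le> K * (norm ?u * norm ?\<rho>)" using t by (intro mult_right_mono) auto
      finally have 1: "cmod (propag (ham Q) t ?u ?u - w * (norm ?u)\<^sup>2) \<le> K * (norm ?u * norm ?\<rho>)" .
      have "w * (norm ?u)\<^sup>2 - w = w * of_real ((norm ?u)\<^sup>2 - 1)" by (simp add: algebra_simps)
      hence 2: "cmod (w * (norm ?u)\<^sup>2 - w) = \<bar>(norm ?u)\<^sup>2 - 1\<bar>"
        by (simp only: norm_mult norm_of_real) (simp add: w_def)
      have "propag (ham Q) t u u - w = (propag (ham Q) t u u - propag (ham Q) t ?u ?u)
          + (propag (ham Q) t ?u ?u - w * (norm ?u)\<^sup>2) + (w * (norm ?u)\<^sup>2 - w)" by simp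
      hence "cmod (propag (ham Q) t u u - w) \<le> cmod (propag (ham Q) t u u - propag (ham Q) t ?u ?u)
          + cmod (propag (ham Q) t ?u ?u - w * (norm ?u)\<^sup>2) + cmod (w * (norm ?u)\<^sup>2 - w)"
        by (metis norm_triangle_le norm_triangle_ineq add_right_mono)
      hence "cmod (propag (ham Q) t u u - w) < e"
        using 1 2 ham.propag_perturb[of Q t u u ?u ?u] elim unfolding g_def by linarith
      thus "cmod (propag (ham Q) t u u - cis (t * (1 - q Q)) * cis (- (t * s Q * \<mu>))) < e"
        by (simp add: w_def cis_mult algebra_simps)
    qed
  qed
qed

section \<open>Eigenvectors of the hopping matrix\<close>

definition \<omega> :: real where "\<omega> = sqrt (\<alpha>\<^sup>2 + \<beta>\<^sup>2)"
definition y\<^sub>0 :: real where "y\<^sub>0 = \<alpha> / \<omega>"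
definition z\<^sub>0 :: real where "z\<^sub>0 = \<beta> / \<omega>"

abbreviation "h \<equiv> 1 / sqrt 2 :: real"

text \<open>Together with \<open>e_minus\<close>, the normalized sum and difference of
  \<open>X\<close> and the unit vector with coordinates \<open>y\<^sub>0\<close>,
  \<open>z\<^sub>0\<close> on \<open>Y\<close>, \<open>Z\<close>, which is the direction reached by
  hopping from \<open>X\<close>.\<close>

definition "e_plus = h *\<^sub>R X + (h * y\<^sub>0) *\<^sub>R Y + (h * z\<^sub>0) *\<^sub>R Z"
definition "e_minus = h *\<^sub>R X + (- h * y\<^sub>0) *\<^sub>R Y + (- h * z\<^sub>0) *\<^sub>R Z"
text \<open>The dark state, orthogonal to \<open>X\<close> and to the direction reached from
  \<open>X\<close>. The coefficient 0 gives it the shape of \<open>mode_combination\<close>.\<close>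

definition "e_null = 0 *\<^sub>R X + z\<^sub>0 *\<^sub>R Y + (- y\<^sub>0) *\<^sub>R Z"

lemma \<omega>_pos: "\<omega> > 0"
  using \<alpha>_pos by (simp add: \<omega>_def add_pos_nonneg)

lemma \<omega>_sq: "\<omega> * \<omega> = \<alpha> * \<alpha> + \<beta> * \<beta>"
  by (simp add: \<omega>_def power2_eq_square flip: power2_eq_square)

lemma yz_sq: "y\<^sub>0\<^sup>2 + z\<^sub>0\<^sup>2 = 1"
proof -
  have "y\<^sub>0\<^sup>2 + z\<^sub>0\<^sup>2 = (\<alpha> * \<alpha> + \<beta> * \<beta>) / (\<omega> * \<omega>)"
    by (simp add: y\<^sub>0_def z\<^sub>0_def power2_eq_square add_divide_distrib)
  thus ?thesis using \<omega>_pos by (simp flip: \<omega>_sq)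
qed

lemma hop_eq: "\<alpha> = \<omega> * y\<^sub>0" "\<beta> = \<omega> * z\<^sub>0"
  using \<omega>_pos by (simp_all add: y\<^sub>0_def z\<^sub>0_def)

lemma y\<^sub>0_pos: "y\<^sub>0 > 0" and z\<^sub>0_nonneg: "z\<^sub>0 \<ge> 0"
  using \<omega>_pos \<alpha>_pos \<beta>_nonneg by (simp_all add: y\<^sub>0_def z\<^sub>0_def)

lemma y\<^sub>0_le: "y\<^sub>0 \<le> 1" and z\<^sub>0_le: "z\<^sub>0 \<le> 1"
  using yz_sq power2_le_imp_le[of y\<^sub>0 1] power2_le_imp_le[of z\<^sub>0 1] by (auto simp: algebra_simps)
    (smt (verit) zero_le_power2)+

lemma mode_plus: "mode \<omega> e_plus"
proof -
  \<comment> \<open>A general factor \<open>c\<close> makes the required identities polynomial; the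
    square root in \<open>h\<close> enters only afterwards.\<close>
  have "mode \<omega> (c *\<^sub>R X + (c * y\<^sub>0) *\<^sub>R Y + (c * z\<^sub>0) *\<^sub>R Z)" for c
    by (rule mode_combination; use hop_eq yz_sq in algebra)
  from this[of h] show ?thesis unfolding e_plus_def .
qed

lemma mode_minus: "mode (- \<omega>) e_minus"
proof -
  have "mode (- \<omega>) (c *\<^sub>R X + (- c * y\<^sub>0) *\<^sub>R Y + (- c * z\<^sub>0) *\<^sub>R Z)" for c
    by (rule mode_combination; use hop_eq yz_sq in algebra)
  from this[of h] show ?thesis unfolding e_minus_def .
qed

lemma mode_null: "mode 0 e_null"
  unfolding e_null_def by (rule mode_combination; (use hop_eq in algebra | simp))

lemma norm_combination: "(norm (d1 *\<^sub>R X + d2 *\<^sub>R Y + d3 *\<^sub>R Z))\<^sup>2 = d1\<^sup>2 + d2\<^sup>2 + d3\<^sup>2"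
  using ret_X[of 0] ret_Y[of 0] ret_Z[of 0] off_XY[of 0] off_XZ[of 0] off_YZ[of 0] a_pos r_0
  unfolding power2_norm_eq_inner
  by (simp add: inner_add_left inner_add_right inner_commute[of Y X]
      inner_commute[of Z X] inner_commute[of Z Y] power2_eq_square)

lemma norm_modes: "norm e_plus = 1" "norm e_minus = 1" "norm e_null = 1"
proof -
  have "(norm e_plus)\<^sup>2 = 1" "(norm e_minus)\<^sup>2 = 1" "(norm e_null)\<^sup>2 = 1"
    unfolding e_plus_def e_minus_def e_null_def norm_combination
    using yz_sq by (simp_all add: power_mult_distrib power_divide flip: add_divide_distrib)
  thus "norm e_plus = 1" "norm e_minus = 1" "norm e_null = 1"
    using norm_ge_zero power2_eq_1_iff by (smt (verit))+
qed

lemma well_states: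
  "X = h *\<^sub>R (e_plus + e_minus)"
  "Y = (h * y\<^sub>0) *\<^sub>R (e_plus - e_minus) + z\<^sub>0 *\<^sub>R e_null"
  "Z = (h * z\<^sub>0) *\<^sub>R (e_plus - e_minus) - y\<^sub>0 *\<^sub>R e_null"
proof -
  have s: "e_plus + e_minus = (2 * h) *\<^sub>R X"
    "e_plus - e_minus = (2 * h * y\<^sub>0) *\<^sub>R Y + (2 * h * z\<^sub>0) *\<^sub>R Z"
    unfolding e_plus_def e_minus_def by (simp_all only: algebra_simps mult_2) simp_all
  show "X = h *\<^sub>R (e_plus + e_minus)" unfolding s by simp
  have "(h * y\<^sub>0) *\<^sub>R (e_plus - e_minus) + z\<^sub>0 *\<^sub>R e_null
      = (y\<^sub>0\<^sup>2 + z\<^sub>0\<^sup>2) *\<^sub>R Y + (y\<^sub>0 * z\<^sub>0 - z\<^sub>0 * y\<^sub>0) *\<^sub>R Z"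
    unfolding s by (simp add: e_null_def scaleR_add_right power2_eq_square scaleR_add_left scaleR_diff_right mult.commute)
  thus "Y = (h * y\<^sub>0) *\<^sub>R (e_plus - e_minus) + z\<^sub>0 *\<^sub>R e_null" by (simp add: yz_sq)
  have "(h * z\<^sub>0) *\<^sub>R (e_plus - e_minus) - y\<^sub>0 *\<^sub>R e_null
      = (z\<^sub>0 * y\<^sub>0 - y\<^sub>0 * z\<^sub>0) *\<^sub>R Y + (y\<^sub>0\<^sup>2 + z\<^sub>0\<^sup>2) *\<^sub>R Z"
    unfolding s by (simp add: e_null_def scaleR_add_right power2_eq_square scaleR_add_left scaleR_diff_right mult.commute)
  thus "Z = (h * z\<^sub>0) *\<^sub>R (e_plus - e_minus) - y\<^sub>0 *\<^sub>R e_null" by (simp add: yz_sq)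
qed

section \<open>Transition amplitudes in terms of the diagonal amplitudes of the modes\<close>

definition "D_plus Q t = propag (ham Q) t e_plus e_plus"
definition "D_minus Q t = propag (ham Q) t e_minus e_minus"
definition "D_null Q t = propag (ham Q) t e_null e_null"

lemma D_le: "cmod (D_plus Q t) \<le> 1" "cmod (D_minus Q t) \<le> 1" "cmod (D_null Q t) \<le> 1"
  unfolding D_plus_def D_minus_def D_null_def
  using ham.cmod_propag_le[of Q t e_plus e_plus] ham.cmod_propag_le[of Q t e_minus e_minus]
    ham.cmod_propag_le[of Q t e_null e_null] by (simp_all add: norm_modes)

text \<open>Exact expansions in the modes. Terms with two different modes are kept apart, since they
  are the ones that \<open>modes_decouple\<close> makes small.\<close>

lemma propag_wells:
  fixes Q t
  defines "B \<equiv> propag (ham Q) t"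
  shows "B X Y = of_real (y\<^sub>0 / 2) * (D_plus Q t - D_minus Q t) + of_real (h * z\<^sub>0) * (B e_plus e_null + B e_minus e_null)"
    and "B X Z = of_real (z\<^sub>0 / 2) * (D_plus Q t - D_minus Q t) - of_real (h * y\<^sub>0) * (B e_plus e_null + B e_minus e_null)"
    and "B Y Z = of_real (y\<^sub>0 * z\<^sub>0) * ((D_plus Q t + D_minus Q t) / 2 - D_null Q t)
      - of_real (y\<^sub>0 * z\<^sub>0) * B e_plus e_minus
      + of_real (h * (z\<^sub>0\<^sup>2 - y\<^sub>0\<^sup>2)) * (B e_plus e_null - B e_minus e_null)"
proof -
  have flip: "B e_minus e_plus = B e_plus e_minus" "B e_null e_plus = B e_plus e_null"
    "B e_null e_minus = B e_minus e_null"
    unfolding B_def by (rule ham.propag_commute)+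
  define H where "H = complex_of_real h"
  have HH: "H * H = 1 / 2"
    unfolding H_def by (simp flip: of_real_mult)
  have HH': "H * (H * c) = c / 2" for c by (metis HH mult.assoc mult_1 times_divide_eq_left)
  note bl = ham.propag_bilinear[of Q t, folded B_def] D_plus_def D_minus_def D_null_def
  have X: "B X v = H * (B e_plus v + B e_minus v)" for v
    by (subst well_states(1)) (simp add: bl H_def)
  have Y: "B v Y = H * of_real y\<^sub>0 * (B v e_plus - B v e_minus) + of_real z\<^sub>0 * B v e_null" for v
    by (subst well_states(2)) (simp only: bl H_def of_real_mult)
  have Y': "B Y v = H * of_real y\<^sub>0 * (B e_plus v - B e_minus v) + of_real z\<^sub>0 * B e_null v" for v
    by (subst well_states(2)) (simp only: bl H_def of_real_mult)
  have Z: "B v Z = H * of_real z\<^sub>0 * (B v e_plus - B v e_minus) - of_real y\<^sub>0 * B v e_null" for v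
    by (subst well_states(3)) (simp only: bl H_def of_real_mult)
  show "B X Y = of_real (y\<^sub>0 / 2) * (D_plus Q t - D_minus Q t) + of_real (h * z\<^sub>0) * (B e_plus e_null + B e_minus e_null)"
    unfolding X Y D_plus_def D_minus_def B_def[symmetric] of_real_mult H_def[symmetric] flip
    by (simp add: algebra_simps HH' add_divide_distrib diff_divide_distrib)
  show "B X Z = of_real (z\<^sub>0 / 2) * (D_plus Q t - D_minus Q t) - of_real (h * y\<^sub>0) * (B e_plus e_null + B e_minus e_null)"
    unfolding X Z D_plus_def D_minus_def B_def[symmetric] of_real_mult H_def[symmetric] flip
    by (simp add: algebra_simps HH' add_divide_distrib diff_divide_distrib)
  show "B Y Z = of_real (y\<^sub>0 * z\<^sub>0) * ((D_plus Q t + D_minus Q t) / 2 - D_null Q t)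
      - of_real (y\<^sub>0 * z\<^sub>0) * B e_plus e_minus
      + of_real (h * (z\<^sub>0\<^sup>2 - y\<^sub>0\<^sup>2)) * (B e_plus e_null - B e_minus e_null)"
    unfolding Y' Z D_plus_def D_minus_def D_null_def B_def[symmetric] of_real_mult H_def[symmetric] flip
    by (simp add: algebra_simps HH' add_divide_distrib diff_divide_distrib power2_eq_square)
qed

lemma amplitudes:
  assumes "e > 0"
  shows "\<forall>\<^sub>F Q in at_top. \<forall>t.
      cmod (propag (ham Q) t X Y - of_real (y\<^sub>0 / 2) * (D_plus Q t - D_minus Q t)) < e \<and>
      cmod (propag (ham Q) t X Z - of_real (z\<^sub>0 / 2) * (D_plus Q t - D_minus Q t)) < e \<and>
      cmod (propag (ham Q) t Y Z - of_real (y\<^sub>0 * z\<^sub>0) * ((D_plus Q t + D_minus Q t) / 2 - D_null Q t)) < e"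
proof -
  \<comment> \<open>At most three overlaps of size \<open>e / 4\<close> enter each error, with
    coefficients of modulus at most 1.\<close>
  have d: "e / 4 > 0" using assms by simp
  have ne: "\<omega> \<noteq> - \<omega>" "\<omega> \<noteq> 0" "- \<omega> \<noteq> 0" using \<omega>_pos by auto
  show ?thesis
    using modes_decouple[OF mode_plus mode_minus ne(1) d] modes_decouple[OF mode_plus mode_null ne(2) d]
      modes_decouple[OF mode_minus mode_null ne(3) d]
  proof eventually_elim
    case (elim Q)
    show ?case
    proof
      fix t
      let ?B = "propag (ham Q) t"
      have B: "cmod (?B e_plus e_minus) < e / 4" "cmod (?B e_plus e_null) < e / 4" "cmod (?B e_minus e_null) < e / 4"
        using elim by auto
      have h1: "\<bar>h\<bar> \<le> 1" by simp
      have k: "\<bar>h * z\<^sub>0\<bar> \<le> 1" "\<bar>h * y\<^sub>0\<bar> \<le> 1" "\<bar>y\<^sub>0 * z\<^sub>0\<bar> \<le> 1" "\<bar>h * (z\<^sub>0\<^sup>2 - y\<^sub>0\<^sup>2)\<bar> \<le> 1"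
      proof -
        have y: "\<bar>y\<^sub>0\<bar> \<le> 1" "\<bar>z\<^sub>0\<bar> \<le> 1" using y\<^sub>0_pos z\<^sub>0_nonneg y\<^sub>0_le z\<^sub>0_le by auto
        have "\<bar>z\<^sub>0\<^sup>2 - y\<^sub>0\<^sup>2\<bar> \<le> 1" using yz_sq by (smt (verit) zero_le_power2)
        thus "\<bar>h * z\<^sub>0\<bar> \<le> 1" "\<bar>h * y\<^sub>0\<bar> \<le> 1" "\<bar>y\<^sub>0 * z\<^sub>0\<bar> \<le> 1" "\<bar>h * (z\<^sub>0\<^sup>2 - y\<^sub>0\<^sup>2)\<bar> \<le> 1"
          unfolding abs_mult using h1 y by (simp_all only: mult_le_one abs_ge_zero)
      qed
      have s: "cmod (?B e_plus e_null + ?B e_minus e_null) \<le> e / 2" "cmod (?B e_plus e_null - ?B e_minus e_null) \<le> e / 2"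
        using B norm_triangle_ineq[of "?B e_plus e_null" "?B e_minus e_null"]
          norm_triangle_ineq4[of "?B e_plus e_null" "?B e_minus e_null"] by linarith+
      have "?B Y Z - of_real (y\<^sub>0 * z\<^sub>0) * ((D_plus Q t + D_minus Q t) / 2 - D_null Q t)
          = of_real (h * (z\<^sub>0\<^sup>2 - y\<^sub>0\<^sup>2)) * (?B e_plus e_null - ?B e_minus e_null) - of_real (y\<^sub>0 * z\<^sub>0) * ?B e_plus e_minus"
        unfolding propag_wells by simp
      hence "cmod (?B Y Z - of_real (y\<^sub>0 * z\<^sub>0) * ((D_plus Q t + D_minus Q t) / 2 - D_null Q t)) \<le> e / 2 + e / 4"
        using norm_triangle_le_diff[OF add_mono[OF norm_le_of_coeff[OF k(4) s(2)] norm_le_of_coeff[OF k(3) less_imp_le[OF B(1)]]]]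
        by simp
      moreover have "cmod (?B X Y - of_real (y\<^sub>0 / 2) * (D_plus Q t - D_minus Q t)) \<le> e / 2"
        unfolding propag_wells using norm_le_of_coeff[OF k(1) s(1)] by simp
      moreover have "cmod (?B X Z - of_real (z\<^sub>0 / 2) * (D_plus Q t - D_minus Q t)) \<le> e / 2"
        unfolding propag_wells using norm_le_of_coeff[OF k(2) s(1)] by simp
      ultimately show "cmod (?B X Y - of_real (y\<^sub>0 / 2) * (D_plus Q t - D_minus Q t)) < e \<and>
        cmod (?B X Z - of_real (z\<^sub>0 / 2) * (D_plus Q t - D_minus Q t)) < e \<and>
        cmod (?B Y Z - of_real (y\<^sub>0 * z\<^sub>0) * ((D_plus Q t + D_minus Q t) / 2 - D_null Q t)) < e"
        using assms by auto
    qed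
  qed
qed

section \<open>Upper bounds valid at all times\<close>

lemma cmod_diff_D: "cmod (D_plus Q t - D_minus Q t) \<le> 2"
  using norm_triangle_ineq4[of "D_plus Q t" "D_minus Q t"] D_le[where Q=Q and t=t] by linarith

lemma cmod_D_null: "cmod ((D_plus Q t + D_minus Q t) / 2 - D_null Q t) \<le> 2"
  using norm_triangle_ineq4[of "(D_plus Q t + D_minus Q t) / 2" "D_null Q t"]
    norm_triangle_ineq[of "D_plus Q t" "D_minus Q t"] D_le[where Q=Q and t=t] by (simp add: norm_divide)

text \<open>At arbitrarily late times the phases are not controlled, so only the modulus bound 1 on
  the diagonal amplitudes is used; each bracket is then at most 2.\<close>

lemma amplitude_upper:
  assumes "e > 0"
  shows "\<forall>\<^sub>F Q in at_top. \<forall>t. cmod (propag (ham Q) t X Y) \<le> y\<^sub>0 + e"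
    and "\<forall>\<^sub>F Q in at_top. \<forall>t. cmod (propag (ham Q) t X Z) \<le> z\<^sub>0 + e"
    and "\<forall>\<^sub>F Q in at_top. \<forall>t. cmod (propag (ham Q) t Y Z) \<le> 2 * y\<^sub>0 * z\<^sub>0 + e"
proof -
  note * = amplitudes[OF assms]
  show "\<forall>\<^sub>F Q in at_top. \<forall>t. cmod (propag (ham Q) t X Y) \<le> y\<^sub>0 + e" using *
  proof eventually_elim
    case (elim Q)
    thus ?case using cmod_le_of_approx[OF _ _ cmod_diff_D, of _ "y\<^sub>0 / 2" Q _ e] y\<^sub>0_pos by auto
  qed
  show "\<forall>\<^sub>F Q in at_top. \<forall>t. cmod (propag (ham Q) t X Z) \<le> z\<^sub>0 + e" using *
  proof eventually_elim
    case (elim Q)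
    thus ?case using cmod_le_of_approx[OF _ _ cmod_diff_D, of _ "z\<^sub>0 / 2" Q _ e] z\<^sub>0_nonneg by auto
  qed
  show "\<forall>\<^sub>F Q in at_top. \<forall>t. cmod (propag (ham Q) t Y Z) \<le> 2 * y\<^sub>0 * z\<^sub>0 + e" using *
  proof eventually_elim
    case (elim Q)
    show ?case
    proof
      fix t
      have "cmod (propag (ham Q) t Y Z - of_real (y\<^sub>0 * z\<^sub>0) * ((D_plus Q t + D_minus Q t) / 2 - D_null Q t)) < e"
        using elim by blast
      from cmod_le_of_approx[OF this _ cmod_D_null] show "cmod (propag (ham Q) t Y Z) \<le> 2 * y\<^sub>0 * z\<^sub>0 + e"
        using z\<^sub>0_nonneg y\<^sub>0_pos by (simp add: algebra_simps)
    qed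
  qed
qed

section \<open>Time scales: short times and the tunneling time\<close>

lemma s_bounds: "\<forall>\<^sub>F Q in at_top. 0 < s Q \<and> s Q * Q ^ (a - 1) \<le> 2 ^ (a - 1) \<and> 1 / s Q \<le> (2 * Q) ^ (a - 1)"
  using eventually_q eventually_gt_at_top[of 0]
proof eventually_elim
  case (elim Q)
  hence q: "q Q > 0" by linarith
  have "s Q * Q ^ (a - 1) = (Q / q Q) ^ (a - 1)" by (simp add: s_def power_divide)
  also have "\<dots> \<le> 2 ^ (a - 1)" using elim q by (intro power_mono) (auto simp: field_simps)
  finally have "s Q * Q ^ (a - 1) \<le> 2 ^ (a - 1)" .
  moreover have "1 / s Q = q Q ^ (a - 1)" by (simp add: s_def power_divide)
  moreover have "q Q ^ (a - 1) \<le> (2 * Q) ^ (a - 1)" using elim q by (intro power_mono) auto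
  ultimately show ?case using q by (simp add: s_def)
qed

text \<open>For times short compared with \<open>1 / s Q\<close> the factor depending on
  \<open>\<mu>\<close> is still close to 1, so every mode carries the same phase.\<close>

lemma mode_phase_short:
  assumes "mode \<mu> u" "norm u = 1" "e > 0"
  shows "\<exists>\<delta>>0. \<forall>\<^sub>F Q in at_top. \<forall>t\<ge>0. t * s Q \<le> \<delta> \<longrightarrow>
    cmod (propag (ham Q) t u u - cis (t * (1 - q Q))) < e"
proof -
  have "isCont (\<lambda>\<tau>. cis (- (\<tau> * \<mu>))) 0"
    unfolding cis_conv_exp by (intro continuous_intros)
  hence "\<exists>d>0. \<forall>\<tau>. \<bar>\<tau>\<bar> < d \<longrightarrow> cmod (cis (- (\<tau> * \<mu>)) - 1) < e / 2"
    unfolding continuous_at_eps_delta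
    by (drule_tac x = "e / 2" in spec) (use assms(3) in \<open>simp add: dist_norm\<close>)
  then obtain d where d: "d > 0" "\<And>\<tau>. \<bar>\<tau>\<bar> < d \<Longrightarrow> cmod (cis (- (\<tau> * \<mu>)) - 1) < e / 2" by blast
  have "\<forall>\<^sub>F Q in at_top. \<forall>t\<ge>0. t * s Q \<le> d / 2 \<longrightarrow>
    cmod (propag (ham Q) t u u - cis (t * (1 - q Q)) * cis (- (t * s Q * \<mu>))) < e / 2"
    using assms d by (intro mode_phase) auto
  hence "\<forall>\<^sub>F Q in at_top. \<forall>t\<ge>0. t * s Q \<le> d / 2 \<longrightarrow>
    cmod (propag (ham Q) t u u - cis (t * (1 - q Q))) < e" using s_bounds
  proof eventually_elim
    case (elim Q)
    show ?case
    proof (intro allI impI)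
      fix t :: real assume t: "t \<ge> 0" "t * s Q \<le> d / 2"
      let ?c = "cis (t * (1 - q Q))" and ?k = "cis (- (t * s Q * \<mu>))" and ?D = "propag (ham Q) t u u"
      have "\<bar>t * s Q\<bar> < d" using t elim d by (simp add: abs_mult)
      hence "cmod (?c * (?k - 1)) < e / 2" using d(2) by (simp add: norm_mult)
      moreover have "cmod (?D - ?c * ?k) < e / 2" using elim t by blast
      moreover have "cmod (?D - ?c) = cmod ((?D - ?c * ?k) + ?c * (?k - 1))"
        by (simp add: algebra_simps)
      ultimately show "cmod (?D - ?c) < e"
        using norm_triangle_ineq[of "?D - ?c * ?k" "?c * (?k - 1)"] by linarith
    qed
  qed
  thus ?thesis using d(1) by (intro exI[of _ "d / 2"]) auto
qed

text \<open>With a common phase in all three modes, the combinations of diagonal amplitudes in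
  \<open>amplitudes\<close> cancel.\<close>

lemma amplitude_short:
  assumes "g \<in> o(\<lambda>Q. Q ^ (a - 1))" "e > 0"
  shows "\<forall>\<^sub>F Q in at_top. \<forall>t\<in>{0..g Q}. cmod (propag (ham Q) t X Y) \<le> e \<and>
    cmod (propag (ham Q) t X Z) \<le> e \<and> cmod (propag (ham Q) t Y Z) \<le> e"
proof -
  have e3: "e / 3 > 0" using assms(2) by simp
  obtain d1 where d1: "d1 > 0" "\<forall>\<^sub>F Q in at_top. \<forall>t\<ge>0. t * s Q \<le> d1 \<longrightarrow>
    cmod (D_plus Q t - cis (t * (1 - q Q))) < e / 3"
    using mode_phase_short[OF mode_plus norm_modes(1) e3] unfolding D_plus_def by blast
  obtain d2 where d2: "d2 > 0" "\<forall>\<^sub>F Q in at_top. \<forall>t\<ge>0. t * s Q \<le> d2 \<longrightarrow>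
    cmod (D_minus Q t - cis (t * (1 - q Q))) < e / 3"
    using mode_phase_short[OF mode_minus norm_modes(2) e3] unfolding D_minus_def by blast
  obtain d3 where d3: "d3 > 0" "\<forall>\<^sub>F Q in at_top. \<forall>t\<ge>0. t * s Q \<le> d3 \<longrightarrow>
    cmod (D_null Q t - cis (t * (1 - q Q))) < e / 3"
    using mode_phase_short[OF mode_null norm_modes(3) e3] unfolding D_null_def by blast
  define d where "d = min d1 (min d2 d3)"
  \<comment> \<open>The factor \<open>2 ^ (a - 1)\<close> accounts for the comparison of
    \<open>1 / s Q\<close> with \<open>Q ^ (a - 1)\<close> in \<open>s_bounds\<close>.\<close>
  have "d / 2 ^ (a - 1) > 0" using d1 d2 d3 by (simp add: d_def)
  hence g: "\<forall>\<^sub>F Q in at_top. norm (g Q) \<le> d / 2 ^ (a - 1) * norm (Q ^ (a - 1))"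
    using assms(1) by (rule landau_o.smallD[rotated])
  show ?thesis using d1(2) d2(2) d3(2) g s_bounds amplitudes[OF e3] eventually_gt_at_top[of 0]
  proof eventually_elim
    case (elim Q)
    show ?case
    proof
      fix t assume t: "t \<in> {0..g Q}"
      have "t * s Q \<le> d / 2 ^ (a - 1) * Q ^ (a - 1) * s Q"
        using t elim by (intro mult_right_mono) auto
      also have "\<dots> = d / 2 ^ (a - 1) * (s Q * Q ^ (a - 1))" by simp
      also have "\<dots> \<le> d / 2 ^ (a - 1) * 2 ^ (a - 1)"
        using elim d1 d2 d3 by (intro mult_left_mono) (auto simp: d_def)
      finally have "t * s Q \<le> d" by simp
      hence c: "cmod (D_plus Q t - cis (t * (1 - q Q))) < e / 3" "cmod (D_minus Q t - cis (t * (1 - q Q))) < e / 3"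
        "cmod (D_null Q t - cis (t * (1 - q Q))) < e / 3"
        using elim t by (auto simp: d_def)
      let ?c = "cis (t * (1 - q Q))"
      have "cmod (D_plus Q t - D_minus Q t) = cmod ((D_plus Q t - ?c) - (D_minus Q t - ?c))" by simp
      hence pm: "cmod (D_plus Q t - D_minus Q t) \<le> 2 * e / 3"
        using norm_triangle_ineq4[of "D_plus Q t - ?c" "D_minus Q t - ?c"] c by linarith
      have "cmod ((D_plus Q t + D_minus Q t) / 2 - D_null Q t)
          = cmod (((D_plus Q t - ?c) + (D_minus Q t - ?c)) / 2 - (D_null Q t - ?c))"
        by (rule arg_cong[of _ _ cmod]) (simp add: field_simps)
      moreover have "cmod (((D_plus Q t - ?c) + (D_minus Q t - ?c)) / 2) \<le> e / 3"
        using norm_triangle_ineq[of "D_plus Q t - ?c" "D_minus Q t - ?c"] c by (simp add: norm_divide)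
      ultimately have n: "cmod ((D_plus Q t + D_minus Q t) / 2 - D_null Q t) \<le> 2 * e / 3"
        using norm_triangle_ineq4[of "((D_plus Q t - ?c) + (D_minus Q t - ?c)) / 2" "D_null Q t - ?c"] c by linarith
      have am: "cmod (propag (ham Q) t X Y - of_real (y\<^sub>0 / 2) * (D_plus Q t - D_minus Q t)) < e / 3"
        "cmod (propag (ham Q) t X Z - of_real (z\<^sub>0 / 2) * (D_plus Q t - D_minus Q t)) < e / 3"
        "cmod (propag (ham Q) t Y Z - of_real (y\<^sub>0 * z\<^sub>0) * ((D_plus Q t + D_minus Q t) / 2 - D_null Q t)) < e / 3"
        using elim by auto
      have small: "k * (2 * e / 3) + e / 3 \<le> e" if "k \<le> 1" for k
        using assms(2) mult_right_mono[OF that, of "2 * e / 3"] by linarith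
      have "y\<^sub>0 * z\<^sub>0 \<le> 1" using y\<^sub>0_pos z\<^sub>0_nonneg y\<^sub>0_le z\<^sub>0_le by (intro mult_le_one)
      thus "cmod (propag (ham Q) t X Y) \<le> e \<and> cmod (propag (ham Q) t X Z) \<le> e \<and> cmod (propag (ham Q) t Y Z) \<le> e"
        using cmod_le_of_approx[OF am(1) _ pm] cmod_le_of_approx[OF am(2) _ pm] cmod_le_of_approx[OF am(3) _ n]
          small[of "y\<^sub>0 / 2"] small[of "z\<^sub>0 / 2"] small[of "y\<^sub>0 * z\<^sub>0"]
          y\<^sub>0_pos z\<^sub>0_nonneg y\<^sub>0_le z\<^sub>0_le by (auto intro: order_trans)
    qed
  qed
qed

text \<open>The absolute value only fixes the sign at the small \<open>Q\<close>, where \<open>q\<close> is unspecified.\<close>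
definition tunnel_time :: "real \<Rightarrow> real" where "tunnel_time Q = \<bar>pi / (2 * \<omega>) / s Q\<bar>"

lemma tunnel_time_bigo: "(\<lambda>Q. k * tunnel_time Q) \<in> O(\<lambda>Q. Q ^ (a - 1))"
proof (rule bigoI)
  show "\<forall>\<^sub>F Q in at_top. norm (k * tunnel_time Q) \<le> \<bar>k\<bar> * (pi / (2 * \<omega>)) * 2 ^ (a - 1) * norm (Q ^ (a - 1))"
    using s_bounds eventually_gt_at_top[of 0]
  proof eventually_elim
    case (elim Q)
    have "norm (k * tunnel_time Q) = \<bar>k\<bar> * (pi / (2 * \<omega>)) * (1 / s Q)"
      using elim \<omega>_pos by (simp add: tunnel_time_def abs_mult abs_divide)
    also have "\<dots> \<le> \<bar>k\<bar> * (pi / (2 * \<omega>)) * (2 * Q) ^ (a - 1)"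
      using elim \<omega>_pos by (intro mult_left_mono) auto
    finally show ?case using elim by (simp add: power_mult_distrib)
  qed
qed

lemma tunnel_time_nonneg: "tunnel_time Q \<ge> 0" by (simp add: tunnel_time_def)

text \<open>At the tunneling time the relative phases of \<open>e_plus\<close> and
  \<open>e_minus\<close> are \<open>- \<i>\<close> and \<open>\<i>\<close>, so their difference has
  modulus near 2. At twice that time both are -1 while the null mode is still at 1, which makes the
  combination for \<open>Y\<close> and \<open>Z\<close> extremal.\<close>

lemma amplitude_lower:
  assumes "e > 0"
  shows "\<forall>\<^sub>F Q in at_top. cmod (propag (ham Q) (tunnel_time Q) X Y) \<ge> y\<^sub>0 - e \<and>
    cmod (propag (ham Q) (tunnel_time Q) X Z) \<ge> z\<^sub>0 - e \<and>
    cmod (propag (ham Q) (2 * tunnel_time Q) Y Z) \<ge> 2 * y\<^sub>0 * z\<^sub>0 - e"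
proof -
  have e3: "e / 3 > 0" using assms by simp
  \<comment> \<open>This window contains both the tunneling time and its double.\<close>
  have K: "0 \<le> pi / \<omega>" using \<omega>_pos by simp
  show ?thesis
    using mode_phase[OF mode_plus norm_modes(1) e3 K] mode_phase[OF mode_minus norm_modes(2) e3 K]
      mode_phase[OF mode_null norm_modes(3) e3 K] amplitudes[OF e3] s_bounds
    unfolding D_plus_def[symmetric] D_minus_def[symmetric] D_null_def[symmetric]
  proof eventually_elim
    case (elim Q)
    define t where "t = tunnel_time Q"
    have t: "t \<ge> 0" "t * s Q = pi / (2 * \<omega>)"
      using elim \<omega>_pos by (simp_all add: t_def tunnel_time_def)
    have t2s: "2 * t * s Q = pi / \<omega>" using t by (simp add: mult.assoc)
    have "pi / (2 * \<omega>) \<le> pi / \<omega>" using \<omega>_pos by (intro divide_left_mono) auto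
    hence ph: "t * s Q * \<omega> = pi / 2" "2 * t * s Q * \<omega> = pi" "t * s Q \<le> pi / \<omega>" "2 * t * s Q \<le> pi / \<omega>"
      unfolding t2s using t \<omega>_pos by simp_all
    define c where "c = cis (t * (1 - q Q))"
    have 1: "cmod (D_plus Q t - c * (- \<i>)) < e / 3"
      using elim(1)[rule_format, OF t(1) ph(3)] by (simp add: c_def ph)
    have 2: "cmod (D_minus Q t - c * \<i>) < e / 3"
      using elim(2)[rule_format, OF t(1) ph(3)] by (simp add: c_def ph)
    have "cmod ((D_plus Q t - D_minus Q t) - (- 2 * \<i>) * c) \<le> 2 * e / 3"
      using norm_triangle_ineq4[of "D_plus Q t - c * (- \<i>)" "D_minus Q t - c * \<i>"] 1 2 by (simp add: algebra_simps)
    moreover have "cmod ((- 2 * \<i>) * c) = 2" by (simp add: c_def norm_mult)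
    ultimately have pm: "cmod (D_plus Q t - D_minus Q t) \<ge> 2 - 2 * e / 3"
      using norm_triangle_sub[of "(- 2 * \<i>) * c" "D_plus Q t - D_minus Q t"]
        norm_minus_commute[of "D_plus Q t - D_minus Q t" "(- 2 * \<i>) * c"] by linarith
    define c' where "c' = cis (2 * t * (1 - q Q))"
    have t2: "2 * t \<ge> 0" using t by simp
    have cis: "cis (- pi) = - 1" by (simp add: complex_eq_iff)
    have 3: "cmod (D_plus Q (2 * t) - (- c')) < e / 3"
      using elim(1)[rule_format, OF t2 ph(4)] by (simp add: c'_def ph cis)
    have 4: "cmod (D_minus Q (2 * t) - (- c')) < e / 3"
      using elim(2)[rule_format, OF t2 ph(4)] by (simp add: c'_def ph cis)
    have 5: "cmod (D_null Q (2 * t) - c') < e / 3"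
      using elim(3)[rule_format, OF t2 ph(4)] by (simp add: c'_def)
    let ?n = "(D_plus Q (2 * t) + D_minus Q (2 * t)) / 2 - D_null Q (2 * t)"
    have "cmod (?n - (- 2 * c'))
        = cmod (((D_plus Q (2 * t) - (- c')) + (D_minus Q (2 * t) - (- c'))) / 2 - (D_null Q (2 * t) - c'))"
      by (rule arg_cong[of _ _ cmod]) (simp add: field_simps)
    moreover have "cmod (((D_plus Q (2 * t) - (- c')) + (D_minus Q (2 * t) - (- c'))) / 2) \<le> e / 3"
      using norm_triangle_ineq[of "D_plus Q (2 * t) - (- c')" "D_minus Q (2 * t) - (- c')"] 3 4 by (simp add: norm_divide)
    ultimately have "cmod (?n - (- 2 * c')) \<le> 2 * e / 3"
      using norm_triangle_ineq4[of "((D_plus Q (2 * t) - (- c')) + (D_minus Q (2 * t) - (- c'))) / 2" "D_null Q (2 * t) - c'"] 5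
      by linarith
    moreover have "cmod (- 2 * c') = 2" by (simp add: c'_def norm_mult)
    ultimately have n: "cmod ?n \<ge> 2 - 2 * e / 3"
      using norm_triangle_sub[of "- 2 * c'" ?n] norm_minus_commute[of ?n "- 2 * c'"] by linarith
    have am: "cmod (propag (ham Q) t X Y - of_real (y\<^sub>0 / 2) * (D_plus Q t - D_minus Q t)) < e / 3"
      "cmod (propag (ham Q) t X Z - of_real (z\<^sub>0 / 2) * (D_plus Q t - D_minus Q t)) < e / 3"
      "cmod (propag (ham Q) (2 * t) Y Z - of_real (y\<^sub>0 * z\<^sub>0) * ?n) < e / 3"
      using elim by auto
    have big: "k * (2 - 2 * e / 3) - e / 3 \<ge> 2 * k - e" if "k \<le> 1" for k
      unfolding right_diff_distrib using assms mult_right_mono[OF that, of "2 * e / 3"] by linarith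
    have yz: "y\<^sub>0 * z\<^sub>0 \<le> 1" "y\<^sub>0 * z\<^sub>0 \<ge> 0" "y\<^sub>0 / 2 \<ge> 0" "z\<^sub>0 / 2 \<ge> 0" "y\<^sub>0 / 2 \<le> 1" "z\<^sub>0 / 2 \<le> 1"
      using y\<^sub>0_pos z\<^sub>0_nonneg y\<^sub>0_le z\<^sub>0_le by (auto intro: mult_le_one)
    show ?case
      using cmod_ge_of_approx[OF am(1) yz(3) pm] cmod_ge_of_approx[OF am(2) yz(4) pm]
        cmod_ge_of_approx[OF am(3) yz(2) n] big[OF yz(1)] big[OF yz(5)] big[OF yz(6)]
      unfolding t_def by (simp add: mult.assoc)
  qed
qed

end

section \<open>Tunneling coefficients\<close>

lemma Liminf_SUP_le:
  assumes "\<And>e. e > 0 \<Longrightarrow> \<forall>\<^sub>F Q in at_top. \<forall>t\<in>S Q. g Q t \<le> k + e"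
  shows "Liminf at_top (\<lambda>Q::real. SUP t\<in>S Q. ereal (g Q t)) \<le> ereal k"
proof (rule ereal_le_epsilon2)
  fix e :: real assume "e > 0"
  hence "\<forall>\<^sub>F Q in at_top. (SUP t\<in>S Q. ereal (g Q t)) \<le> ereal (k + e)"
    using assms[of e] by (auto elim!: eventually_mono intro!: SUP_least)
  hence "Liminf at_top (\<lambda>Q. SUP t\<in>S Q. ereal (g Q t)) \<le> Liminf at_top (\<lambda>Q::real. ereal (k + e))"
    by (rule Liminf_mono)
  thus "Liminf at_top (\<lambda>Q. SUP t\<in>S Q. ereal (g Q t)) \<le> ereal k + ereal e"
    by (simp add: Liminf_const)
qed

lemma le_Liminf_SUP:
  assumes "\<And>e. e > 0 \<Longrightarrow> \<forall>\<^sub>F Q in at_top. \<exists>t\<in>S Q. k - e \<le> g Q t"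
  shows "ereal k \<le> Liminf at_top (\<lambda>Q::real. SUP t\<in>S Q. ereal (g Q t))"
proof (rule ereal_le_epsilon2)
  fix e :: real assume "e > 0"
  hence "\<forall>\<^sub>F Q in at_top. ereal (k - e) \<le> (SUP t\<in>S Q. ereal (g Q t))"
    using assms[of e] by (auto elim!: eventually_mono intro: SUP_upper2)
  hence "Liminf at_top (\<lambda>Q::real. ereal (k - e)) \<le> Liminf at_top (\<lambda>Q. SUP t\<in>S Q. ereal (g Q t))"
    by (rule Liminf_mono)
  hence "ereal (k - e) + ereal e \<le> Liminf at_top (\<lambda>Q. SUP t\<in>S Q. ereal (g Q t)) + ereal e"
    by (intro add_right_mono) (simp add: Liminf_const)
  thus "ereal k \<le> Liminf at_top (\<lambda>Q. SUP t\<in>S Q. ereal (g Q t)) + ereal e" by simp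
qed

lemma TC_eq_TCset: "TC E W u v = TCset E W u {v}"
  by (simp add: TC_def TCset_def)

lemma TC_nonneg: "TC E W u v \<ge> 0"
  unfolding TC_def zero_ereal_def
proof (rule le_Liminf_SUP)
  fix e :: real assume "e > 0"
  hence "0 - e \<le> (cmod (state E W Q u 0 v))\<^sup>2" for Q
    using zero_le_power2[of "cmod (state E W Q u 0 v)"] by linarith
  thus "\<forall>\<^sub>F Q in at_top. \<exists>t\<in>{0..}. 0 - e \<le> (cmod (state E W Q u t v))\<^sup>2"
    by (intro always_eventually allI bexI[of _ 0]) auto
qed

lemma TC_le:
  assumes "k \<ge> 0" and "\<And>e. e > 0 \<Longrightarrow> \<forall>\<^sub>F Q in at_top. \<forall>t. cmod (state E W Q u t v) \<le> k + e"
  shows "TC E W u v \<le> ereal (k\<^sup>2)"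
  unfolding TC_def
proof (rule Liminf_SUP_le)
  fix e :: real assume e: "e > 0"
  \<comment> \<open>Since \<open>d \<le> 1\<close>, squaring \<open>k + d\<close> exceeds the square
    of \<open>k\<close> by at most \<open>d * (2 * k + 1)\<close>, hence by at most
    \<open>e\<close>.\<close>
  define d where "d = min 1 (e / (2 * k + 1))"
  have "d \<le> e / (2 * k + 1)" by (simp add: d_def)
  hence "d * (2 * k + 1) \<le> e" using assms(1) by (simp add: pos_le_divide_eq)
  moreover have "d > 0" "d \<le> 1" using e assms(1) by (simp_all add: d_def)
  ultimately have d: "d > 0" "d \<le> 1" "d * (2 * k + 1) \<le> e" by auto
  have "d * d \<le> d" using d mult_left_mono[of d 1 d] by linarith
  moreover have "(k + d)\<^sup>2 = k\<^sup>2 + d * (2 * k + 1) + (d * d - d)"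
    by (simp add: power2_eq_square algebra_simps)
  ultimately have "(k + d)\<^sup>2 \<le> k\<^sup>2 + e" using d(3) by linarith
  moreover have "(cmod w)\<^sup>2 \<le> (k + d)\<^sup>2" if "cmod w \<le> k + d" for w
    using that by (intro power_mono) auto
  ultimately have "(cmod w)\<^sup>2 \<le> k\<^sup>2 + e" if "cmod w \<le> k + d" for w
    using that order_trans by blast
  thus "\<forall>\<^sub>F Q in at_top. \<forall>t\<in>{0..}. (cmod (state E W Q u t v))\<^sup>2 \<le> k\<^sup>2 + e"
    using assms(2)[OF d(1)] by (auto elim: eventually_mono)
qed

text \<open>Probability near 1 at the times \<open>\<tau>\<close> gives both the coefficient and the
  upper time bound; probability near 0 up to any time in \<open>o(g)\<close> excludes shorter
  scales.\<close>

lemma perfect_tunneling: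
  assumes unit: "\<And>Q t. (\<Sum>v\<in>S. (cmod (state E W Q u t v))\<^sup>2) \<le> 1"
    and \<tau>: "\<And>Q. \<tau> Q \<ge> 0" "\<tau> \<in> O(g)"
    and low: "\<And>e. e > 0 \<Longrightarrow> \<forall>\<^sub>F Q in at_top. (\<Sum>v\<in>S. (cmod (state E W Q u (\<tau> Q) v))\<^sup>2) \<ge> 1 - e"
    and short: "\<And>f e. f \<in> o(g) \<Longrightarrow> e > 0 \<Longrightarrow>
      \<forall>\<^sub>F Q in at_top. \<forall>t\<in>{0..f Q}. (\<Sum>v\<in>S. (cmod (state E W Q u t v))\<^sup>2) \<le> e"
  shows "TCset E W u S = 1" "tunnel_time_Theta E W u S g"
proof -
  have up: "\<forall>\<^sub>F Q in at_top. \<forall>t\<in>R Q. (\<Sum>v\<in>S. (cmod (state E W Q u t v))\<^sup>2) \<le> 1 + e" if "e > 0" for e and R :: "real \<Rightarrow> real set"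
    using unit that by (intro always_eventually allI ballI) (smt (verit))
  show TC: "TCset E W u S = 1"
    unfolding TCset_def one_ereal_def
  proof (intro antisym Liminf_SUP_le le_Liminf_SUP)
    fix e :: real assume "e > 0"
    thus "\<forall>\<^sub>F Q in at_top. \<exists>t\<in>{0..}. 1 - e \<le> (\<Sum>v\<in>S. (cmod (state E W Q u t v))\<^sup>2)"
      using low \<tau>(1) by (fastforce elim: eventually_mono)
  qed (rule up)
  have "TCset_within E W u S \<tau> = 1"
    unfolding TCset_within_def one_ereal_def
  proof (intro antisym Liminf_SUP_le le_Liminf_SUP)
    fix e :: real assume "e > 0"
    thus "\<forall>\<^sub>F Q in at_top. \<exists>t\<in>{0..\<tau> Q}. 1 - e \<le> (\<Sum>v\<in>S. (cmod (state E W Q u t v))\<^sup>2)"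
      using low \<tau>(1) by (fastforce elim: eventually_mono)
  qed (rule up)
  moreover have "TCset_within E W u S f \<noteq> 1" if "f \<in> o(g)" for f
  proof -
    \<comment> \<open>Only an upper bound is claimed: where \<open>f Q\<close> is negative the
      interval is empty and the supremum is minus infinity.\<close>
    have "TCset_within E W u S f \<le> ereal 0"
      unfolding TCset_within_def using short[OF that] by (intro Liminf_SUP_le) simp
    thus ?thesis by auto
  qed
  ultimately show "tunnel_time_Theta E W u S g"
    unfolding tunnel_time_Theta_def tunnels_within_def TC using \<tau>(2) by metis
qed

section \<open>Walks on the graph\<close>

text \<open>The real counterpart of \<open>matvec\<close>, on a type with an inner product, so that
  \<open>selfadjoint\<close> applies.\<close>

definition matmul :: "('a::finite \<Rightarrow> 'a \<Rightarrow> real) \<Rightarrow> real ^ 'a \<Rightarrow> real ^ 'a" where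
  "matmul M \<theta> = (\<chi> v. \<Sum>w\<in>UNIV. M v w * \<theta> $ w)"

lemma selfadjoint_matmul:
  assumes "\<And>v w. M v w = M w v"
  shows "selfadjoint (matmul M)"
proof (rule selfadjoint.intro)
  show "linear (matmul M)"
    by (rule linearI) (simp_all add: matmul_def vec_eq_iff sum.distrib sum_distrib_left algebra_simps)
  fix u v
  have "matmul M u \<bullet> v = (\<Sum>i\<in>UNIV. \<Sum>j\<in>UNIV. M i j * u $ j * v $ i)"
    by (simp add: inner_vec_def matmul_def sum_distrib_right)
  also have "\<dots> = (\<Sum>j\<in>UNIV. \<Sum>i\<in>UNIV. M i j * u $ j * v $ i)" by (rule sum.swap)
  also have "\<dots> = (\<Sum>j\<in>UNIV. \<Sum>i\<in>UNIV. u $ j * (M j i * v $ i))"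
    by (intro sum.cong refl) (metis assms mult.assoc mult.left_commute)
  also have "\<dots> = u \<bullet> matmul M v"
    by (simp add: inner_vec_def matmul_def sum_distrib_left)
  finally show "matmul M u \<bullet> v = u \<bullet> matmul M v" .
qed

lemma matvec_pow: "(matvec M ^^ n) (chi u) v = of_real ((matmul M ^^ n) (axis u 1) $ v)"
proof (induction n arbitrary: v)
  case 0
  show ?case by (simp add: chi_def axis_def)
next
  case (Suc n)
  thus ?case by (simp add: matvec_def matmul_def)
qed

lemma state_eq_propag: "state E W Q u t v = propag (matmul (Ham E W Q)) t (axis v 1) (axis u 1)"
  unfolding state_def propag_def matvec_pow by (simp add: inner_axis')

section \<open>The normalized adjacency matrix and weighted walks\<close>

definition adj :: "('a::finite \<Rightarrow> 'a \<Rightarrow> bool) \<Rightarrow> 'a \<Rightarrow> 'a \<Rightarrow> real" where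
  "adj E v w = (if E v w then 1 / sqrt (real (deg E v) * real (deg E w)) else 0)"

lemma adj_pow_Suc: "(matmul (adj E) ^^ Suc n) \<theta> $ v = (\<Sum>w\<in>UNIV. adj E v w * (matmul (adj E) ^^ n) \<theta> $ w)"
  by (simp add: matmul_def)

text \<open>The index set of the sum in \<open>cpath\<close> with the length left free, which allows
  induction on it.\<close>

definition walks :: "('a \<Rightarrow> 'a \<Rightarrow> bool) \<Rightarrow> nat \<Rightarrow> 'a \<Rightarrow> 'a \<Rightarrow> 'a list set" where
  "walks E l u v = {xs. length xs = Suc l \<and> xs ! 0 = u \<and> xs ! l = v \<and> (\<forall>j<l. E (xs ! j) (xs ! Suc j))}"

lemma finite_walks: "finite (walks E l u (v::'a::finite))"
  by (rule finite_subset[OF _ finite_lists_length_eq[of UNIV "Suc l"]]) (auto simp: walks_def)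

lemma walks_Suc: "walks E (Suc l) u v = (\<Union>w\<in>{w. E w v}. (\<lambda>xs. xs @ [v]) ` walks E l u w)"
proof (intro equalityI subsetI)
  fix xs assume xs: "xs \<in> walks E (Suc l) u v"
  hence len: "length xs = Suc (Suc l)" by (simp add: walks_def)
  have "butlast xs \<in> walks E l u (xs ! l)"
    using xs by (auto simp: walks_def nth_butlast)
  moreover have "xs = butlast xs @ [v]"
    using xs len append_butlast_last_id[of xs] last_conv_nth[of xs]
    by (cases "xs = []") (auto simp: walks_def)
  moreover have "E (xs ! l) v" using xs by (auto simp: walks_def)
  ultimately show "xs \<in> (\<Union>w\<in>{w. E w v}. (\<lambda>xs. xs @ [v]) ` walks E l u w)" by blast
next
  fix xs assume "xs \<in> (\<Union>w\<in>{w. E w v}. (\<lambda>xs. xs @ [v]) ` walks E l u w)"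
  then obtain ys where ys: "xs = ys @ [v]" "E (ys ! l) v" "ys \<in> walks E l u (ys ! l)"
    by (auto simp: walks_def)
  thus "xs \<in> walks E (Suc l) u v"
    by (auto simp: walks_def nth_append less_Suc_eq)
qed

lemma sum_walks_Suc:
  fixes v :: "'a::finite"
  shows "(\<Sum>xs\<in>walks E (Suc l) u v. g xs) = (\<Sum>w | E w v. \<Sum>xs\<in>walks E l u w. g (xs @ [v]))"
proof -
  have "(\<Sum>xs\<in>walks E (Suc l) u v. g xs) = (\<Sum>w | E w v. \<Sum>xs\<in>(\<lambda>xs. xs @ [v]) ` walks E l u w. g xs)"
    unfolding walks_Suc by (rule sum.UNION_disjoint) (auto simp: finite_walks, auto simp: walks_def)
  also have "\<dots> = (\<Sum>w | E w v. \<Sum>xs\<in>walks E l u w. g (xs @ [v]))"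
    by (simp add: sum.reindex inj_on_def)
  finally show ?thesis .
qed

context
  fixes E :: "'a::finite \<Rightarrow> 'a \<Rightarrow> bool"
  assumes simple: "simple_graph E"
begin

lemma adj_commute: "adj E v w = adj E w v"
  using simple by (auto simp: adj_def simple_graph_def mult.commute)

lemma deg_pos: "E v w \<Longrightarrow> deg E v > 0" "E v w \<Longrightarrow> deg E w > 0"
  using simple by (auto simp: deg_def simple_graph_def card_gt_0_iff)

lemma adj_pos: "E v w \<Longrightarrow> adj E v w > 0"
  using deg_pos by (simp add: adj_def)

lemma adj_nonneg: "adj E v w \<ge> 0"
  by (simp add: adj_def)

lemma adj_pow_nonneg: "(matmul (adj E) ^^ n) (axis u 1) $ v \<ge> 0"
proof (induction n arbitrary: v)
  case (Suc n)
  thus ?case unfolding adj_pow_Suc by (intro sum_nonneg mult_nonneg_nonneg adj_nonneg)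
qed (simp add: axis_def)

text \<open>All terms are nonnegative, so nothing cancels: an entry of the power is positive as soon
  as one walk contributes.\<close>

lemma adj_pow_pos_iff: "(matmul (adj E) ^^ n) (axis u 1) $ v > 0 \<longleftrightarrow> (E ^^ n) u v"
proof (induction n arbitrary: v)
  case 0
  show ?case by (simp add: axis_def)
next
  case (Suc n)
  have nn: "adj E v w * (matmul (adj E) ^^ n) (axis u 1) $ w \<ge> 0" for w
    by (intro mult_nonneg_nonneg adj_nonneg adj_pow_nonneg)
  have "(matmul (adj E) ^^ Suc n) (axis u 1) $ v > 0
      \<longleftrightarrow> (\<exists>w. adj E v w * (matmul (adj E) ^^ n) (axis u 1) $ w > 0)"
    unfolding adj_pow_Suc using nn by (metis (no_types, lifting) UNIV_I finite less_le sum_nonneg sum_nonneg_eq_0_iff)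
  also have "\<dots> \<longleftrightarrow> (\<exists>w. E v w \<and> (E ^^ n) u w)"
    using adj_pos adj_nonneg Suc.IH by (metis adj_def adj_pow_nonneg less_irrefl mult_pos_pos mult_zero_left zero_less_mult_pos)
  also have "\<dots> \<longleftrightarrow> (E ^^ Suc n) u v"
    using simple by (auto simp: simple_graph_def)
  finally show ?case .
qed

lemma adj_pow_eq_0: "n < gdist E u v \<Longrightarrow> (matmul (adj E) ^^ n) (axis u 1) $ v = 0"
  using adj_pow_pos_iff[of n u v] adj_pow_nonneg[of n u v] not_less_Least[of n "\<lambda>n. (E ^^ n) u v"]
  unfolding gdist_def by linarith

lemma adj_pow_gdist_pos:
  assumes "connected_graph E"
  shows "(matmul (adj E) ^^ gdist E u v) (axis u 1) $ v > 0"
proof -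
  have "\<exists>n. (E ^^ n) u v" using assms by (simp add: connected_graph_def rtranclp_power)
  thus ?thesis unfolding adj_pow_pos_iff gdist_def by (rule LeastI_ex)
qed

lemma adj_pow_walks:
  "(matmul (adj E) ^^ n) (axis u 1) $ v =
    (\<Sum>xs\<in>walks E n u v. \<Prod>j<n. 1 / sqrt (real (deg E (xs ! j)) * real (deg E (xs ! Suc j))))"
proof (induction n arbitrary: v)
  case 0
  have "walks E 0 u v = (if u = v then {[u]} else {})"
    by (auto simp: walks_def length_Suc_conv)
  thus ?case by (simp add: axis_def)
next
  case (Suc n)
  let ?w = "\<lambda>x y. 1 / sqrt (real (deg E x) * real (deg E y))"
  have "(\<Sum>xs\<in>walks E (Suc n) u v. \<Prod>j<Suc n. ?w (xs ! j) (xs ! Suc j))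
      = (\<Sum>w | E w v. \<Sum>xs\<in>walks E n u w. \<Prod>j<Suc n. ?w ((xs @ [v]) ! j) ((xs @ [v]) ! Suc j))"
    by (rule sum_walks_Suc)
  also have "\<dots> = (\<Sum>w | E w v. \<Sum>xs\<in>walks E n u w. (\<Prod>j<n. ?w (xs ! j) (xs ! Suc j)) * ?w w v)"
  proof (intro sum.cong refl)
    fix w xs assume "xs \<in> walks E n u w"
    hence xs: "length xs = Suc n" "xs ! n = w" by (auto simp: walks_def)
    have "(\<Prod>j<n. ?w ((xs @ [v]) ! j) ((xs @ [v]) ! Suc j)) = (\<Prod>j<n. ?w (xs ! j) (xs ! Suc j))"
      by (intro prod.cong) (auto simp: nth_append xs)
    thus "(\<Prod>j<Suc n. ?w ((xs @ [v]) ! j) ((xs @ [v]) ! Suc j)) = (\<Prod>j<n. ?w (xs ! j) (xs ! Suc j)) * ?w w v"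
      by (simp only: prod.lessThan_Suc) (simp add: nth_append xs)
  qed
  also have "\<dots> = (\<Sum>w | E w v. (matmul (adj E) ^^ n) (axis u 1) $ w * ?w w v)"
    unfolding Suc.IH by (simp only: sum_distrib_right)
  also have "\<dots> = (\<Sum>w\<in>UNIV. if E w v then (matmul (adj E) ^^ n) (axis u 1) $ w * ?w w v else 0)"
    by (simp add: sum.If_cases)
  also have "\<dots> = (matmul (adj E) ^^ Suc n) (axis u 1) $ v"
    unfolding adj_pow_Suc adj_commute[of v] by (intro sum.cong) (auto simp: adj_def)
  finally show ?case by simp
qed

lemma cpath_eq: "cpath E u v = (matmul (adj E) ^^ gdist E u v) (axis u 1) $ v"
  unfolding cpath_def Let_def adj_pow_walks walks_def ..

text \<open>The random walk operator is conjugate to \<open>adj E\<close> by the square roots of the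
  degrees. On the diagonal they cancel, which turns cospectrality into equality of diagonal entries
  of powers.\<close>

lemma rw_step_pow:
  assumes deg: "\<And>v. deg E v > 0"
  shows "(rw_step E ^^ k) (\<lambda>w. if w = u then 1 else 0) v
    = sqrt (real (deg E v)) / sqrt (real (deg E u)) * (matmul (adj E) ^^ k) (axis u 1) $ v"
proof (induction k arbitrary: v)
  case 0
  show ?case using deg[of u] by (simp add: axis_def)
next
  case (Suc k)
  let ?p = "(rw_step E ^^ k) (\<lambda>w. if w = u then 1 else 0)" and ?a = "(matmul (adj E) ^^ k) (axis u 1)"
  let ?d = "\<lambda>v. sqrt (real (deg E v))"
  have d: "?d v > 0" "?d v * ?d v = real (deg E v)" for v using deg[of v] by auto
  have "?p w * (if E w v then 1 / real (deg E w) else 0) = ?d v / ?d u * (adj E v w * ?a $ w)" for w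
  proof (cases "E w v")
    case True
    have "adj E v w = 1 / (?d v * ?d w)"
      using True adj_commute[of v w] by (simp add: adj_def real_sqrt_mult mult.commute)
    moreover have "1 / real (deg E w) = 1 / (?d w * ?d w)" by (simp only: d)
    \<comment> \<open>Here \<open>p\<close>, \<open>q\<close>, \<open>r\<close> stand for the square
      roots of the degrees of \<open>v\<close>, \<open>w\<close>, \<open>u\<close>.\<close>
    moreover have "q / r * b * (1 / (q * q)) = p / r * (1 / (p * q) * b)" if "p > 0" "q > 0" "r > 0" for p q r b :: real
      using that by (simp add: field_simps)
    ultimately show ?thesis
      unfolding Suc.IH using True d(1)[of v] d(1)[of w] d(1)[of u] by (simp only: if_True)
  next
    case False
    thus ?thesis using adj_commute[of v w] by (simp add: adj_def)
  qed
  moreover have "(rw_step E ^^ Suc k) (\<lambda>w. if w = u then 1 else 0) v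
      = (\<Sum>w\<in>UNIV. ?p w * (if E w v then 1 / real (deg E w) else 0))"
    by (simp add: rw_step_def[of E ?p])
  ultimately show ?case
    unfolding adj_pow_Suc by (simp only: sum_distrib_left)
qed

lemma PR_eq:
  assumes "\<And>v. deg E v > 0"
  shows "PR E u k = (matmul (adj E) ^^ k) (axis u 1) $ u"
  unfolding PR_def rw_step_pow[OF assms] using assms[of u] by simp

end

lemma deg_pos_of_connected:
  fixes x y v :: "'a::finite"
  assumes "connected_graph E" "x \<noteq> y"
  shows "deg E v > 0"
proof -
  obtain w where "w \<noteq> v" using assms(2) by metis
  moreover have "E\<^sup>*\<^sup>* v w" using assms(1) by (simp add: connected_graph_def)
  ultimately obtain w' where "E v w'" by (metis converse_rtranclpE)
  thus ?thesis by (auto simp: deg_def card_gt_0_iff)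
qed

lemma sum_propag_axis_le:
  fixes T :: "real ^ 'a::finite \<Rightarrow> real ^ 'a"
  assumes "selfadjoint T"
  shows "(\<Sum>v\<in>S. (cmod (propag T t (axis v 1) \<theta>))\<^sup>2) \<le> (norm \<theta>)\<^sup>2"
proof -
  have "(\<Sum>v\<in>S. (cmod (propag T t (axis v 1) \<theta>))\<^sup>2) \<le> (\<Sum>v\<in>UNIV. (cmod (propag T t (axis v 1) \<theta>))\<^sup>2)"
    by (rule sum_mono2) auto
  also have "\<dots> = (\<Sum>b\<in>(\<lambda>v. axis v 1) ` UNIV. (cmod (propag T t b \<theta>))\<^sup>2)"
    by (subst sum.reindex) (auto simp: inj_on_def axis_eq_axis)
  also have "(\<lambda>v. axis v 1) ` UNIV = (Basis :: (real ^ 'a) set)"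
    by (auto simp: Basis_vec_def)
  finally show ?thesis using selfadjoint.propag_norm_preserved[OF assms] by metis
qed

text \<open>The parabola lies above its tangent at \<open>k\<close>.\<close>

lemma square_ge: "k\<^sup>2 - 2 * k * d \<le> c\<^sup>2" if "k \<ge> 0" "k - d \<le> c" for c k d :: real
  using that mult_left_mono[of "k - d" c "2 * k"] zero_le_power2[of "c - k"]
  by (simp add: power2_eq_square algebra_simps)

section \<open>From the graph to the three wells, and the comparison of distances\<close>

theorem theorem2:
  fixes E :: "'a::finite \<Rightarrow> 'a \<Rightarrow> bool" and x y z :: 'a and a b c :: nat and W :: "'a \<Rightarrow> real"
  assumes "simple_graph E" and "connected_graph E"
    and "x \<noteq> y" and "x \<noteq> z" and "y \<noteq> z"
    and "a = gdist E x y" and "b = gdist E x z" and "c = gdist E y z"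
    and "a \<le> b" and "b \<le> c"
    and "cospectral E c x y" and "cospectral E c x z" and "cospectral E c y z"
    and "W = (\<lambda>v. if v \<in> {x, y, z} then 1 else 0)"
  shows
   "(a < b \<longrightarrow>
        TC E W x y = 1 \<and> TC E W y x = 1 \<and>
        tunnel_time_Theta E W x {y} (\<lambda>Q. Q ^ (a - 1)) \<and>
        tunnel_time_Theta E W y {x} (\<lambda>Q. Q ^ (a - 1)) \<and>
        TC E W x z = 0 \<and> TC E W z x = 0 \<and> TC E W y z = 0 \<and> TC E W z y = 0)
    \<and> (a = b \<and> b < c \<longrightarrow>
        TC E W x y < 1 \<and> TC E W x z < 1 \<and>
        TCset E W x {y, z} = 1 \<and>
        tunnel_time_Theta E W x {y, z} (\<lambda>Q. Q ^ (a - 1)))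
    \<and> (a = b \<and> b < c \<longrightarrow>
        (TC E W y z = 1 \<longleftrightarrow> cpath E x y = cpath E x z) \<and>
        (cpath E x y = cpath E x z \<longrightarrow> tunnel_time_Theta E W y {z} (\<lambda>Q. Q ^ (a - 1))))"
proof (cases "a < c")
  \<comment> \<open>Then \<open>a = b = c\<close>, and all three implications are vacuous.\<close>
  case False
  thus ?thesis using assms(9,10) by auto
next
  case ac: True
  note simple = assms(1)
  define A where "A = matmul (adj E)"
  define X Y Z :: "real ^ 'a" where "X = axis x 1" and "Y = axis y 1" and "Z = axis z 1"
  note XYZ = X_def Y_def Z_def
  interpret A: selfadjoint A
    unfolding A_def by (rule selfadjoint_matmul) (rule adj_commute[OF simple])
  have flip: "u \<bullet> (A ^^ k) v = v \<bullet> (A ^^ k) u" for u v k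
    using A.selfadj_pow[of k u v] by (simp add: inner_commute)
  have entry: "axis w 1 \<bullet> (A ^^ k) (axis u 1) = (matmul (adj E) ^^ k) (axis u 1) $ w" for w u k
    by (simp add: A_def inner_axis')
  define r where "r k = X \<bullet> (A ^^ k) X" for k
  define \<alpha> where "\<alpha> = X \<bullet> (A ^^ a) Y"
  define \<beta> where "\<beta> = X \<bullet> (A ^^ a) Z"
  have deg: "deg E v > 0" for v by (rule deg_pos_of_connected[OF assms(2,3)])
  have PR: "PR E u k = axis u 1 \<bullet> (A ^^ k) (axis u 1)" for u k
    unfolding PR_eq[OF simple deg] entry ..
  have zero: "axis u 1 \<bullet> (A ^^ k) (axis v 1) = 0" if "k < gdist E u v" for u v k
    using adj_pow_eq_0[OF simple that] entry[of v k u] flip[of "axis u 1" k "axis v 1"] by simp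
  have \<alpha>: "\<alpha> = cpath E x y"
    unfolding \<alpha>_def using flip[of X a Y] entry[of y a x] by (simp add: XYZ cpath_eq[OF simple] assms(6))
  have \<beta>: "\<beta> = cpath E x z" if "a = b"
    unfolding \<beta>_def using that flip[of X a Z] entry[of z a x] by (simp add: XYZ cpath_eq[OF simple] assms(7))
  have \<beta>0: "\<beta> = 0" if "a < b"
    using that zero[of a x z] assms(7) by (simp add: \<beta>_def XYZ)
  have cpath_pos: "cpath E u v > 0" for u v
    unfolding cpath_eq[OF simple] by (rule adj_pow_gdist_pos[OF simple assms(2)])
  have \<beta>_nonneg: "\<beta> \<ge> 0"
    using \<beta>0 \<beta> cpath_pos[of x z] assms(9) by (cases "a = b") auto
  interpret tw: three_wells A X Y Z a r \<alpha> \<beta>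
  proof
    \<comment> \<open>For \<open>a = 0\<close> the positive number \<open>\<alpha>\<close> would be
      the inner product of two different basis vectors.\<close>
    show "a > 0" using assms(3) zero[of 0 x x] \<alpha> cpath_pos[of x y] by (cases a) (auto simp: \<alpha>_def XYZ inner_axis_axis)
    show "X \<bullet> (A ^^ k) X = r k" for k by (simp add: r_def)
    show "Y \<bullet> (A ^^ k) Y = r k" if "k \<le> a" for k
      using that assms(9-11) PR[of x k] PR[of y k] by (simp add: r_def XYZ cospectral_def)
    show "Z \<bullet> (A ^^ k) Z = r k" if "k \<le> a" for k
      using that assms(9,10,12) PR[of x k] PR[of z k] by (simp add: r_def XYZ cospectral_def)
    show "r 0 = 1" by (simp add: r_def XYZ inner_axis_axis)
    show "X \<bullet> (A ^^ k) Y = 0" if "k < a" for k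
      unfolding XYZ using that assms(6) by (intro zero) simp
    show "X \<bullet> (A ^^ k) Z = 0" if "k < a" for k
      unfolding XYZ using that assms(7,9) by (intro zero) simp
    \<comment> \<open>The instance \<open>k = a\<close> is where \<open>a < c\<close>
      enters.\<close>
    show "Y \<bullet> (A ^^ k) Z = 0" if "k \<le> a" for k
      unfolding XYZ using that ac assms(8) by (intro zero) simp
    show "X \<bullet> (A ^^ a) Y = \<alpha>" "X \<bullet> (A ^^ a) Z = \<beta>" by (simp_all add: \<alpha>_def \<beta>_def)
    show "\<alpha> > 0" using \<alpha> cpath_pos by simp
    show "\<beta> \<ge> 0" by (rule \<beta>_nonneg)
  qed
  \<comment> \<open>Multiplication by \<open>W\<close> is the projection \<open>tw.well\<close>, and
    the Laplacian is the identity minus \<open>A\<close>.\<close>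
  have ham: "matmul (Ham E W Q) = tw.ham Q" for Q
  proof
    fix \<theta> :: "real ^ 'a"
    have "matmul (Ham E W Q) \<theta> $ v = tw.ham Q \<theta> $ v" for v
    proof -
      have H: "Ham E W Q v w = (if v = w then 1 - Q * W v else 0) - adj E v w" for w
        using simple by (auto simp: Ham_def Lap_def adj_def simple_graph_def)
      have "matmul (Ham E W Q) \<theta> $ v = (\<Sum>w\<in>UNIV. (if v = w then (1 - Q * W v) * \<theta> $ w else 0) - adj E v w * \<theta> $ w)"
        unfolding matmul_def H vec_lambda_beta by (intro sum.cong) (auto simp: algebra_simps)
      also have "\<dots> = (1 - Q * W v) * \<theta> $ v - A \<theta> $ v"
        by (simp add: sum_subtractf A_def matmul_def)
      moreover have "\<theta> \<bullet> X = \<theta> $ x" "\<theta> \<bullet> Y = \<theta> $ y" "\<theta> \<bullet> Z = \<theta> $ z"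
        by (simp_all add: XYZ inner_axis)
      hence "W v * \<theta> $ v = tw.well \<theta> $ v"
        unfolding tw.well_def using assms(3-5) by (auto simp: assms(14) XYZ axis_def)
      hence "(1 - Q * W v) * \<theta> $ v - A \<theta> $ v = tw.ham Q \<theta> $ v"
        by (simp add: tw.ham_def algebra_simps)
      ultimately show ?thesis by simp
    qed
    thus "matmul (Ham E W Q) \<theta> = tw.ham Q \<theta>" by (simp add: vec_eq_iff)
  qed
  have st: "state E W Q u t v = propag (tw.ham Q) t (axis v 1) (axis u 1)" for Q u t v
    unfolding state_eq_propag ham ..
  have st': "state E W Q u t v = propag (tw.ham Q) t (axis u 1) (axis v 1)" for Q u t v
    unfolding st by (rule tw.ham.propag_commute)
  have unit: "(\<Sum>v\<in>S. (cmod (state E W Q u t v))\<^sup>2) \<le> 1" for S Q u t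
    unfolding st using sum_propag_axis_le[OF tw.selfadjoint_ham[of Q], of t "axis u 1" S] by simp
  have sXY: "state E W Q x t y = propag (tw.ham Q) t X Y" "state E W Q y t x = propag (tw.ham Q) t X Y" for Q t
    using st'[of Q x t y] st[of Q y t x] by (simp_all only: flip: XYZ)
  have sXZ: "state E W Q x t z = propag (tw.ham Q) t X Z" "state E W Q z t x = propag (tw.ham Q) t X Z" for Q t
    using st'[of Q x t z] st[of Q z t x] by (simp_all only: flip: XYZ)
  have sYZ: "state E W Q y t z = propag (tw.ham Q) t Y Z" "state E W Q z t y = propag (tw.ham Q) t Y Z" for Q t
    using st'[of Q y t z] st[of Q z t y] by (simp_all only: flip: XYZ)
  note nn = tw.y\<^sub>0_pos tw.z\<^sub>0_nonneg
  have TC_XY: "TC E W x y \<le> ereal (tw.y\<^sub>0\<^sup>2)"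
    using nn by (intro TC_le) (auto simp: sXY intro: tw.amplitude_upper)
  have TC_XZ: "TC E W x z \<le> ereal (tw.z\<^sub>0\<^sup>2)" "TC E W z x \<le> ereal (tw.z\<^sub>0\<^sup>2)"
    using nn by (intro TC_le; auto simp: sXZ intro: tw.amplitude_upper)+
  have TC_YZ: "TC E W y z \<le> ereal ((2 * tw.y\<^sub>0 * tw.z\<^sub>0)\<^sup>2)" "TC E W z y \<le> ereal ((2 * tw.y\<^sub>0 * tw.z\<^sub>0)\<^sup>2)"
    using nn by (intro TC_le; auto simp: sYZ intro: tw.amplitude_upper)+
  have small_sq: "m\<^sup>2 \<le> e" if "m \<le> sqrt e" "m \<ge> 0" "e > 0" for m e :: real
    using that power_mono[of m "sqrt e" 2] by simp
  have bigo: "tw.tunnel_time \<in> O(\<lambda>Q. Q ^ (a - 1))" "(\<lambda>Q. 2 * tw.tunnel_time Q) \<in> O(\<lambda>Q. Q ^ (a - 1))"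
    using tw.tunnel_time_bigo[of 1] tw.tunnel_time_bigo[of 2] by simp_all
  have near: "TC E W x y = 1" "TC E W y x = 1"
    "tunnel_time_Theta E W x {y} (\<lambda>Q. Q ^ (a - 1))" "tunnel_time_Theta E W y {x} (\<lambda>Q. Q ^ (a - 1))"
    if "tw.y\<^sub>0 = 1"
  proof -
    have low: "\<forall>\<^sub>F Q in at_top. 1 - e \<le> (cmod (propag (tw.ham Q) (tw.tunnel_time Q) X Y))\<^sup>2" if "e > 0" for e
    proof -
      have "e / 2 > 0" using that by simp
      from tw.amplitude_lower[OF this] show ?thesis
      proof eventually_elim
        case (elim Q)
        thus ?case
          using square_ge[of 1 "e / 2" "cmod (propag (tw.ham Q) (tw.tunnel_time Q) X Y)"] \<open>tw.y\<^sub>0 = 1\<close> by simp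
      qed
    qed
    have short: "\<forall>\<^sub>F Q in at_top. \<forall>t\<in>{0..f Q}. (cmod (propag (tw.ham Q) t X Y))\<^sup>2 \<le> e"
      if "f \<in> o(\<lambda>Q. Q ^ (a - 1))" "e > 0" for f e
      using tw.amplitude_short[OF that(1), of "sqrt e"] that(2)
      by (auto elim!: eventually_mono intro!: small_sq)
    show "TC E W x y = 1" "tunnel_time_Theta E W x {y} (\<lambda>Q. Q ^ (a - 1))"
      unfolding TC_eq_TCset
      by (rule perfect_tunneling[OF unit tw.tunnel_time_nonneg bigo(1)]; simp add: sXY low short)+
    show "TC E W y x = 1" "tunnel_time_Theta E W y {x} (\<lambda>Q. Q ^ (a - 1))"
      unfolding TC_eq_TCset
      by (rule perfect_tunneling[OF unit tw.tunnel_time_nonneg bigo(1)]; simp add: sXY low short)+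
  qed
  \<comment> \<open>The amplitudes to \<open>Y\<close> and \<open>Z\<close> peak at the same time,
    with limiting probabilities that add up to 1 by \<open>tw.yz_sq\<close>.\<close>
  have mixed: "TCset E W x {y, z} = 1" "tunnel_time_Theta E W x {y, z} (\<lambda>Q. Q ^ (a - 1))"
  proof -
    have low: "\<forall>\<^sub>F Q in at_top. 1 - e \<le> (cmod (propag (tw.ham Q) (tw.tunnel_time Q) X Y))\<^sup>2
        + (cmod (propag (tw.ham Q) (tw.tunnel_time Q) X Z))\<^sup>2" if "e > 0" for e
    proof -
      have "e / 4 > 0" using that by simp
      from tw.amplitude_lower[OF this] show ?thesis
      proof eventually_elim
        case (elim Q)
        have "2 * tw.y\<^sub>0 * (e / 4) \<le> e / 2" "2 * tw.z\<^sub>0 * (e / 4) \<le> e / 2"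
          using that tw.y\<^sub>0_le tw.z\<^sub>0_le by simp_all
        moreover have "tw.y\<^sub>0\<^sup>2 - 2 * tw.y\<^sub>0 * (e / 4) \<le> (cmod (propag (tw.ham Q) (tw.tunnel_time Q) X Y))\<^sup>2"
          "tw.z\<^sub>0\<^sup>2 - 2 * tw.z\<^sub>0 * (e / 4) \<le> (cmod (propag (tw.ham Q) (tw.tunnel_time Q) X Z))\<^sup>2"
          using elim nn by (intro square_ge; simp)+
        ultimately show ?case using tw.yz_sq by linarith
      qed
    qed
    have short: "\<forall>\<^sub>F Q in at_top. \<forall>t\<in>{0..f Q}. (cmod (propag (tw.ham Q) t X Y))\<^sup>2 + (cmod (propag (tw.ham Q) t X Z))\<^sup>2 \<le> e"
      if "f \<in> o(\<lambda>Q. Q ^ (a - 1))" "e > 0" for f e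
    proof -
      have "sqrt (e / 2) > 0" using that(2) by simp
      from tw.amplitude_short[OF that(1) this] show ?thesis
      proof eventually_elim
        case (elim Q)
        show ?case
        proof
          fix t assume "t \<in> {0..f Q}"
          hence "cmod (propag (tw.ham Q) t X Y) \<le> sqrt (e / 2)" "cmod (propag (tw.ham Q) t X Z) \<le> sqrt (e / 2)"
            using elim by blast+
          from this[THEN small_sq]
          have "(cmod (propag (tw.ham Q) t X Y))\<^sup>2 \<le> e / 2" "(cmod (propag (tw.ham Q) t X Z))\<^sup>2 \<le> e / 2"
            using that(2) by simp_all
          thus "(cmod (propag (tw.ham Q) t X Y))\<^sup>2 + (cmod (propag (tw.ham Q) t X Z))\<^sup>2 \<le> e" by simp
        qed
      qed
    qed
    show "TCset E W x {y, z} = 1" "tunnel_time_Theta E W x {y, z} (\<lambda>Q. Q ^ (a - 1))"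
      by (rule perfect_tunneling[OF unit tw.tunnel_time_nonneg bigo(1)]; simp add: sXY sXZ assms(5) low short)+
  qed
  \<comment> \<open>Transfer from \<open>y\<close> to \<open>z\<close> passes through the modes
    shared with \<open>x\<close> and peaks at twice the tunneling time.\<close>
  have far: "TC E W y z = 1" "tunnel_time_Theta E W y {z} (\<lambda>Q. Q ^ (a - 1))" if "2 * tw.y\<^sub>0 * tw.z\<^sub>0 = 1"
  proof -
    have low: "\<forall>\<^sub>F Q in at_top. 1 - e \<le> (cmod (propag (tw.ham Q) (2 * tw.tunnel_time Q) Y Z))\<^sup>2" if "e > 0" for e
    proof -
      have "e / 2 > 0" using that by simp
      from tw.amplitude_lower[OF this] show ?thesis
      proof eventually_elim
        case (elim Q)
        thus ?case
          using square_ge[of 1 "e / 2" "cmod (propag (tw.ham Q) (2 * tw.tunnel_time Q) Y Z)"]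
            \<open>2 * tw.y\<^sub>0 * tw.z\<^sub>0 = 1\<close> by simp
      qed
    qed
    have short: "\<forall>\<^sub>F Q in at_top. \<forall>t\<in>{0..f Q}. (cmod (propag (tw.ham Q) t Y Z))\<^sup>2 \<le> e"
      if "f \<in> o(\<lambda>Q. Q ^ (a - 1))" "e > 0" for f e
      using tw.amplitude_short[OF that(1), of "sqrt e"] that(2)
      by (auto elim!: eventually_mono intro!: small_sq)
    have nonneg: "0 \<le> 2 * tw.tunnel_time Q" for Q using tw.tunnel_time_nonneg by simp
    show "TC E W y z = 1" "tunnel_time_Theta E W y {z} (\<lambda>Q. Q ^ (a - 1))"
      unfolding TC_eq_TCset
      by (rule perfect_tunneling[OF unit nonneg bigo(2)]; simp add: sYZ low short)+
  qed
  have "tw.y\<^sub>0 = 1 \<and> tw.z\<^sub>0 = 0" if "a < b"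
  proof -
    have "tw.z\<^sub>0 = 0" unfolding tw.z\<^sub>0_def using \<beta>0[OF that] by simp
    thus ?thesis using tw.yz_sq nn by (simp add: power2_eq_1_iff)
  qed
  hence part1: "a < b \<longrightarrow>
        TC E W x y = 1 \<and> TC E W y x = 1 \<and>
        tunnel_time_Theta E W x {y} (\<lambda>Q. Q ^ (a - 1)) \<and>
        tunnel_time_Theta E W y {x} (\<lambda>Q. Q ^ (a - 1)) \<and>
        TC E W x z = 0 \<and> TC E W z x = 0 \<and> TC E W y z = 0 \<and> TC E W z y = 0"
    using near TC_XZ TC_YZ TC_nonneg[of E W] by (auto intro!: antisym simp: zero_ereal_def)
  \<comment> \<open>For \<open>a = b\<close> both hopping amplitudes are positive, so neither of two
    squares with sum 1 can reach 1.\<close>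
  have part2: "TC E W x y < 1 \<and> TC E W x z < 1" if "a = b"
  proof -
    have "\<beta> > 0" using \<beta>[OF that] cpath_pos by simp
    hence "tw.z\<^sub>0 > 0" using tw.\<omega>_pos by (simp add: tw.z\<^sub>0_def)
    hence "tw.y\<^sub>0\<^sup>2 > 0" "tw.z\<^sub>0\<^sup>2 > 0" using nn by simp_all
    hence "tw.y\<^sub>0\<^sup>2 < 1" "tw.z\<^sub>0\<^sup>2 < 1" using tw.yz_sq by linarith+
    thus ?thesis using TC_XY TC_XZ(1)
      by (metis less_ereal.simps(1) one_ereal_def order_le_less_trans)
  qed
  have part3: "(TC E W y z = 1 \<longleftrightarrow> cpath E x y = cpath E x z) \<and>
        (cpath E x y = cpath E x z \<longrightarrow> tunnel_time_Theta E W y {z} (\<lambda>Q. Q ^ (a - 1)))" if "a = b"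
  proof -
    \<comment> \<open>The limiting amplitude from \<open>y\<close> to \<open>z\<close> falls short
      of 1 by exactly this square, so it is perfect only for equal hopping to both sides.\<close>
    have sq: "(tw.y\<^sub>0 - tw.z\<^sub>0)\<^sup>2 = 1 - 2 * tw.y\<^sub>0 * tw.z\<^sub>0"
      using tw.yz_sq by (simp add: power2_eq_square algebra_simps)
    have "\<alpha> = \<beta> \<longleftrightarrow> tw.y\<^sub>0 = tw.z\<^sub>0"
      unfolding tw.y\<^sub>0_def tw.z\<^sub>0_def using tw.\<omega>_pos by simp
    hence eq: "cpath E x y = cpath E x z \<longleftrightarrow> tw.y\<^sub>0 = tw.z\<^sub>0"
      using \<alpha> \<beta>[OF that] by simp
    have "TC E W y z < 1" if "tw.y\<^sub>0 \<noteq> tw.z\<^sub>0"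
    proof -
      have "(tw.y\<^sub>0 - tw.z\<^sub>0)\<^sup>2 > 0" using that by simp
      hence "2 * tw.y\<^sub>0 * tw.z\<^sub>0 < 1" using sq by linarith
      hence "(2 * tw.y\<^sub>0 * tw.z\<^sub>0)\<^sup>2 < 1" using nn unfolding abs_square_less_1 by simp
      thus ?thesis using TC_YZ(1) by (metis less_ereal.simps(1) one_ereal_def order_le_less_trans)
    qed
    thus ?thesis using far sq eq by auto
  qed
  show ?thesis using part1 part2 part3 mixed by blast
qed

end
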